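(* The Grassmann Expansion Hypothesis (GEH) holds if and only if the Inverse Shortcode Hypothesis (ISH) holds. (GEH): For every $\eta>0$ there exist $\delta>0$ and an integer $r$, depending only on $\eta$, such that for all $\ell,n$: if $S\subseteq\mathcal{V}_{\ell}$ satisfies $\Phi_{\mathcal{G}(\ell,n)}(S)<\eta$, then there are subspaces $Q,W$ of $\mathbb{F}_2^n$ of dimension $r_1$ and codimension $r_2$ respectively, with $r_1+r_2\le r$, such that $\Pr_{V:\,Q\subseteq V\subseteq W}[V\in S]\ge\delta$, where $V$ is uniform among $\ell$-dimensional subspaces with $Q\subseteq V\subseteq W$. (ISH): For every $\eta>0$ there exist $\delta>0$ and an integer $r$, depending only on $\eta$, such that for all $\ell,n$ and every $S\subseteq\mathsf{Mat}_{\ell,n}$: if $\Pr_{M\sim S,\,a\sim\mathbb{F}_2^{\ell},\,b\sim\mathbb{F}_2^{n}}[M+ab^{\top}\in S]\ge\eta$, then there exists an $r$-nice set $T\subseteq\mathsf{Mat}_{\ell,n}$ with $|S\cap T|\ge\delta|T|$.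
   Context: $\mathcal{V}_{\ell}$ is the set of all $\ell$-dimensional subspaces of $\mathbb{F}_2^n$. The Grassmann graph $\mathcal{G}(\ell,n)$ has vertex set $\mathcal{V}_{\ell}$, with $V,V'$ adjacent iff $\dim(V\cap V')=\ell-1$. For a regular graph $G$ and vertex set $S$, $\Phi_G(S)=\Pr_{v\sim S,\,v'\sim v}[v'\notin S]$, where $v$ is uniform in $S$ and $v'$ is a uniform neighbor of $v$. $\mathsf{Mat}_{\ell,n}$ is the set of $\ell\times n$ matrices over $\mathbb{F}_2$; $x\sim X$ denotes a uniform sample, samples independent. A right affine subspace of $\mathsf{Mat}_{\ell,n}$ is a set $\{M: Mq_i=t_i,\ i\le r_1\}$ ($q_i\in\mathbb{F}_2^n$, $t_i\in\mathbb{F}_2^\ell$); a left affine subspace is a set $\{M: s_j^{\top}M=u_j^{\top},\ j\le r_2\}$ ($s_j\in\mathbb{F}_2^\ell$, $u_j\in\mathbb{F}_2^n$). A set is $r$-nice if it is the intersection of a right affine subspace with $r_1$ constraints and a left affine subspace with $r_2$ constraints, $r_1+r_2=r$.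
   Formalization: In GEH, η ranges over 0<η<1, since for η≥1 it fails (one vertex, or two adjacent ones); also 0<ℓ<n, S and the set of V with Q⊆V⊆W are nonempty so the probabilities exist; in ISH, S and the r-nice sets are nonempty, as an empty T would make it trivial. *)

theory Defs
  imports
    "HOL-Probability.Probability_Mass_Function"
    "HOL-Library.Z2"
    "Jordan_Normal_Form.VS_Connect"
begin

text \<open>
  The field with two elements is the type \<^typ>\<open>bit\<close>. Since \<open>n\<close> is quantified inside the
  hypotheses, vectors and matrices are the carrier-based ones of \<^theory>\<open>Jordan_Normal_Form.Matrix\<close>;
  the space of all binary vectors of length \<open>n\<close> is \<open>module_vec TYPE(bit) n\<close>.
\<close>

abbreviation F2_subspace :: "nat \<Rightarrow> bit Matrix.vec set \<Rightarrow> bool" where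
  "F2_subspace n V \<equiv> VectorSpace.subspace class_ring V (module_vec TYPE(bit) n)"

definition F2_dim :: "nat \<Rightarrow> bit Matrix.vec set \<Rightarrow> nat" where
  "F2_dim n V = vectorspace.dim class_ring (module_vec TYPE(bit) n\<lparr>carrier := V\<rparr>)"

definition grassmann_verts :: "nat \<Rightarrow> nat \<Rightarrow> bit Matrix.vec set set" where
  "grassmann_verts l n = {V. F2_subspace n V \<and> F2_dim n V = l}"

text \<open>
  The condition is written with \<open>+ 1\<close> instead of truncated subtraction, so that there is no loop
  at the single vertex for \<open>l = 0\<close>.
\<close>

definition grassmann_nbrs :: "nat \<Rightarrow> nat \<Rightarrow> bit Matrix.vec set \<Rightarrow> bit Matrix.vec set set" where
  "grassmann_nbrs l n V = {V' \<in> grassmann_verts l n. F2_dim n (V \<inter> V') + 1 = l}"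

text \<open>
  The argument \<open>N\<close> maps a vertex to its set of neighbours. The value is meaningful only if \<open>S\<close>
  is finite and nonempty and all its elements have finite nonempty neighbourhoods.
\<close>

definition expansion :: "('v \<Rightarrow> 'v set) \<Rightarrow> 'v set \<Rightarrow> real" where
  "expansion N S =
     measure_pmf.prob (pmf_of_set S \<bind> (\<lambda>v. pmf_of_set (N v))) {v'. v' \<notin> S}"

definition zoom :: "nat \<Rightarrow> nat \<Rightarrow> bit Matrix.vec set \<Rightarrow> bit Matrix.vec set \<Rightarrow> bit Matrix.vec set set" where
  "zoom l n Q W = {V \<in> grassmann_verts l n. Q \<subseteq> V \<and> V \<subseteq> W}"

text \<open>
  Here \<open>\<eta>\<close> ranges over \<open>(0, 1)\<close>: expansion is a probability, and for \<open>\<eta> > 1\<close> every nonempty set,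
  in particular every single vertex, would satisfy the premise, so that the hypothesis
  would be false for trivial reasons. The condition \<open>0 < l < n\<close> says exactly that the
  Grassmann graph has edges, so that a uniform neighbour exists.
\<close>

definition GEH :: bool where
  "GEH \<longleftrightarrow>
    (\<forall>\<eta>::real. 0 < \<eta> \<and> \<eta> < 1 \<longrightarrow>
      (\<exists>\<delta>::real. \<exists>r::nat. \<delta> > 0 \<and>
        (\<forall>l n S. 0 < l \<and> l < n \<and> S \<subseteq> grassmann_verts l n \<and> S \<noteq> {} \<and>
            expansion (grassmann_nbrs l n) S < \<eta> \<longrightarrow>
          (\<exists>r1 r2 Q W. r1 + r2 \<le> r \<and>
            F2_subspace n Q \<and> F2_dim n Q = r1 \<and>
            F2_subspace n W \<and> F2_dim n W + r2 = n \<and>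
            zoom l n Q W \<noteq> {} \<and>
            measure_pmf.prob (pmf_of_set (zoom l n Q W)) S \<ge> \<delta>))))"

definition right_affine :: "nat \<Rightarrow> nat \<Rightarrow> nat \<Rightarrow> bit Matrix.mat set \<Rightarrow> bool" where
  "right_affine l n r A \<longleftrightarrow>
    (\<exists>q t. (\<forall>i<r. q i \<in> carrier_vec n \<and> t i \<in> carrier_vec l) \<and>
      A = {M \<in> carrier_mat l n. \<forall>i<r. M *\<^sub>v q i = t i})"

text \<open>The equation between row vectors \<open>s\<^sup>T M = u\<^sup>T\<close> is stated in transposed form.\<close>

definition left_affine :: "nat \<Rightarrow> nat \<Rightarrow> nat \<Rightarrow> bit Matrix.mat set \<Rightarrow> bool" where
  "left_affine l n r B \<longleftrightarrow>
    (\<exists>s u. (\<forall>j<r. s j \<in> carrier_vec l \<and> u j \<in> carrier_vec n) \<and>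
      B = {M \<in> carrier_mat l n. \<forall>j<r. transpose_mat M *\<^sub>v s j = u j})"

text \<open>
  Nonemptiness, implicit in the word ``affine'', has to be required: inconsistent constraints
  would otherwise make the empty set nice, and every set has density at least \<open>\<delta>\<close> in it.
\<close>

definition nice :: "nat \<Rightarrow> nat \<Rightarrow> nat \<Rightarrow> bit Matrix.mat set \<Rightarrow> bool" where
  "nice l n r T \<longleftrightarrow> T \<noteq> {} \<and>
    (\<exists>r1 r2 A B. r1 + r2 = r \<and> right_affine l n r1 A \<and> left_affine l n r2 B \<and> T = A \<inter> B)"

definition outer_prod :: "bit Matrix.vec \<Rightarrow> bit Matrix.vec \<Rightarrow> bit Matrix.mat" where
  "outer_prod a b =
     Matrix.mat (dim_vec a) (dim_vec b) (\<lambda>(i, j). Matrix.vec_index a i * Matrix.vec_index b j)"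

definition shortcode_stay :: "nat \<Rightarrow> nat \<Rightarrow> bit Matrix.mat set \<Rightarrow> real" where
  "shortcode_stay l n S =
     measure_pmf.prob
       (pair_pmf (pmf_of_set S) (pair_pmf (pmf_of_set (carrier_vec l)) (pmf_of_set (carrier_vec n))))
       {(M, a, b). M + outer_prod a b \<in> S}"

definition ISH :: bool where
  "ISH \<longleftrightarrow>
    (\<forall>\<eta>::real. 0 < \<eta> \<longrightarrow>
      (\<exists>\<delta>::real. \<exists>r::nat. \<delta> > 0 \<and>
        (\<forall>l n S. S \<subseteq> carrier_mat l n \<and> S \<noteq> {} \<and> shortcode_stay l n S \<ge> \<eta> \<longrightarrow>
          (\<exists>T. nice l n r T \<and> real (card (S \<inter> T)) \<ge> \<delta> * real (card T)))))"

end

theory Submission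
  imports Defs
begin

text \<open>
  A matrix \<open>M\<close> is identified with the \<open>l\<close>-dimensional subspace
  \<open>{(x, M\<^sup>T x)}\<close> of \<open>\<F>\<^sub>2\<^sup>l\<^sup>+\<^sup>m\<close>. The image of this embedding consists of
  the complements of \<open>0 \<times> \<F>\<^sub>2\<^sup>m\<close>, a shortcode step \<open>M + a b\<^sup>T\<close> with \<open>a, b \<noteq> 0\<close> is a step of the
  Grassmann graph, and a constraint \<open>s\<^sup>T M = u\<^sup>T\<close> says that \<open>(s, u)\<close> lies in the subspace of \<open>M\<close>,
  while \<open>M q = t\<close> says that this subspace is orthogonal to \<open>(t, q)\<close>. Nice sets are therefore the
  traces of zooms.

  For GEH \<open>\<Longrightarrow>\<close> ISH, embed \<open>S\<close>: since the Grassmann degree is at most \<open>8 \<cdot> 2\<^sup>l\<^sup>+\<^sup>m\<close>, the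
  probability of staying in \<open>S\<close> drops only by a constant factor. (If \<open>l\<close> or \<open>m\<close> is bounded, a single
  matrix is already nice.) For ISH \<open>\<Longrightarrow>\<close> GEH, pull \<open>S\<close> back along the embedding followed by
  a random linear automorphism. Automorphisms act transitively on the edges of the Grassmann graph,
  so on average, and hence for some automorphism, the pulled back set is stable under shortcode steps.
  The density in a nice set passes to the zoom because at least a quarter of the subspaces of a zoom
  are complements of \<open>0 \<times> \<F>\<^sub>2\<^sup>m\<close>.
\<close>

section \<open>Binary subspaces as sets of vectors\<close>

text \<open>The steps with \<open>a = 0\<close> or \<open>b = 0\<close> leave a matrix fixed and
  have no counterpart in the Grassmann graph. They occur with probability at most
  \<open>2^-l + 2^-m\<close>, which may account for the whole stay probability when \<open>l\<close>
  or \<open>m\<close> is small; this forces the separate treatment of bounded parameters. In the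
  converse direction they can only help, because there a lower bound on the stay probability is
  wanted. Automorphisms have to be transitive on ordered edges, not only on vertices: then the image
  of a shortcode edge, conditioned on its first end lying in \<open>S\<close>, is exactly a random
  step from \<open>S\<close>. The pulled back sets vary in size, so the averaging is done with
  counts and not with probabilities. The losses of 4 and 8 come from two facts: the product of the
  factors \<open>1 - 2^-j\<close> stays above 1/4, and at least a quarter of all pairs
  \<open>(a, b)\<close> have both entries nonzero. Dimensions are handled as exponents of two in
  cardinalities.\<close>

type_synonym bvec = "bit Matrix.vec"

text \<open>Z2 rewrites ring operations to bit operations, which disables the simplification of sums.\<close>
declare add_bit_eq_xor [simp del] mult_bit_eq_and [simp del]

text \<open>Over the field with two elements an additive subgroup is the same as a subspace, since
  the scalars are only 0 and 1.\<close>

definition bit_subspace :: "nat \<Rightarrow> bvec set \<Rightarrow> bool" where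
  "bit_subspace n V \<longleftrightarrow> V \<subseteq> carrier_vec n \<and> 0\<^sub>v n \<in> V \<and> (\<forall>x\<in>V. \<forall>y\<in>V. x + y \<in> V)"

lemma vec_add_self: "x \<in> carrier_vec n \<Longrightarrow> x + x = 0\<^sub>v n" for x :: bvec
  by (intro eq_vecI) auto

lemma vec_add_self_left:
  fixes x y :: bvec
  assumes "x \<in> carrier_vec n" "y \<in> carrier_vec n"
  shows "x + (x + y) = y"
  using assms by (intro eq_vecI) (auto simp flip: add.assoc)

lemma vec_add_eq_zero_iff:
  fixes x y :: bvec
  assumes "x \<in> carrier_vec n" "y \<in> carrier_vec n"
  shows "x + y = 0\<^sub>v n \<longleftrightarrow> x = y"
proof
  assume "x + y = 0\<^sub>v n"
  then have "x + (x + y) = x"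
    using assms by simp
  then show "x = y"
    using vec_add_self_left[OF assms] by simp
qed (use assms vec_add_self in auto)

lemma F2_subspace_iff: "F2_subspace n V \<longleftrightarrow> bit_subspace n V"
proof
  assume "F2_subspace n V"
  then have "submodule class_ring V (module_vec TYPE(bit) n)"
    by (simp add: VectorSpace.subspace_def)
  then show "bit_subspace n V"
    by (auto simp: submodule_def bit_subspace_def module_vec_simps)
next
  assume V: "bit_subspace n V"
  have "c \<cdot>\<^sub>v v \<in> V" if "v \<in> V" for c v
  proof (cases c)
    case zero
    have "v \<in> carrier_vec n"
      using V that by (auto simp: bit_subspace_def)
    then have "(0::bit) \<cdot>\<^sub>v v = 0\<^sub>v n"
      by auto
    then show ?thesis
      using V zero by (simp add: bit_subspace_def)
  next
    case one
    then show ?thesis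
      using that by simp
  qed
  then have "submodule class_ring V (module_vec TYPE(bit) n)"
    using V vec_module[of n, where 'a = bit]
    by (auto simp: submodule_def bit_subspace_def module_vec_simps)
  then show "F2_subspace n V"
    by (simp add: VectorSpace.subspace_def vec_vs)
qed

lemma UNIV_bit: "(UNIV :: bit set) = {0, 1}"
  by (auto intro: bit.exhaust)

lemma card_UNIV_bit: "CARD(bit) = 2"
  by (simp add: UNIV_bit)

lemma card_carrier_vec_bit: "card (carrier_vec n :: bvec set) = 2 ^ n"
  and finite_carrier_vec_bit [simp]: "finite (carrier_vec n :: bvec set)"
proof -
  have *: "bij_betw (\<lambda>f. Matrix.vec n f) ({..<n} \<rightarrow>\<^sub>E (UNIV :: bit set)) (carrier_vec n)"
  proof (rule bij_betwI[where g = "\<lambda>v. restrict (vec_index v) {..<n}"], goal_cases)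
    case (3 x)
    then show ?case
      by (auto simp: PiE_def extensional_def fun_eq_iff)
  next
    case (4 y)
    then show ?case
      by (intro eq_vecI) auto
  qed auto
  show "card (carrier_vec n :: bvec set) = 2 ^ n"
    using bij_betw_same_card[OF *] by (simp add: card_PiE card_UNIV_bit)
  show "finite (carrier_vec n :: bvec set)"
    using bij_betw_finite[OF *] by (simp add: UNIV_bit finite_PiE)
qed

text \<open>Coordinates with respect to a basis identify \<open>V\<close> with the functions from
  the basis to \<open>bit\<close>. This is the bridge from the dimension of the vector space library
  to plain counting.\<close>

lemma card_bit_subspace_dim:
  assumes V: "bit_subspace n V"
  shows "card V = 2 ^ F2_dim n V"
proof -
  let ?V = "module_vec TYPE(bit) n\<lparr>carrier := V\<rparr>"
  interpret A: vectorspace "class_ring :: bit ring" "module_vec TYPE(bit) n"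
    by (rule vec_vs)
  have sp: "F2_subspace n V"
    using V by (simp add: F2_subspace_iff)
  interpret W: vectorspace "class_ring :: bit ring" ?V
    using A.subspace_is_vs[OF sp] by simp
  have finV: "finite V"
    using V finite_subset[OF _ finite_carrier_vec_bit] by (auto simp: bit_subspace_def)
  \<comment> \<open>\<open>V\<close> is its own finite spanning set.\<close>
  have "W.fin_dim"
    unfolding W.fin_dim_def
    by (rule exI[of _ V]) (use finV W.in_own_span[of V] W.span_is_subset2[of V] in auto)
  then obtain B where B: "finite B" "W.basis B"
    using W.finite_basis_exists by blast
  have BV: "B \<subseteq> V"
    using B(2) by (auto simp: W.basis_def)
  have ex1: "\<exists>!a. a \<in> B \<rightarrow>\<^sub>E (UNIV :: bit set) \<and> W.lincomb a B = v" if "v \<in> V" for v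
    using W.basis_criterion[of B] B BV that by auto
  have inj: "inj_on (\<lambda>a. W.lincomb a B) (B \<rightarrow>\<^sub>E (UNIV :: bit set))"
  proof (rule inj_onI)
    fix a b assume ab: "a \<in> B \<rightarrow>\<^sub>E (UNIV :: bit set)" "b \<in> B \<rightarrow>\<^sub>E (UNIV :: bit set)"
      "W.lincomb a B = W.lincomb b B"
    have "W.lincomb a B \<in> carrier ?V"
      by (rule W.lincomb_closed) (use BV in auto)
    then have "W.lincomb a B \<in> V"
      by simp
    with ex1[OF this] ab show "a = b"
      by metis
  qed
  have "(\<lambda>a. W.lincomb a B) ` (B \<rightarrow>\<^sub>E (UNIV :: bit set)) = V"
  proof
    show "V \<subseteq> (\<lambda>a. W.lincomb a B) ` (B \<rightarrow>\<^sub>E (UNIV :: bit set))"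
      using ex1 by (metis (no_types, lifting) image_eqI subsetI)
    have "W.lincomb a B \<in> carrier ?V" for a
      by (rule W.lincomb_closed) (use BV in auto)
    then show "(\<lambda>a. W.lincomb a B) ` (B \<rightarrow>\<^sub>E (UNIV :: bit set)) \<subseteq> V"
      by auto
  qed
  then have "card V = card (B \<rightarrow>\<^sub>E (UNIV :: bit set))"
    using card_image[OF inj] by simp
  moreover have "CARD(bit) = 2"
    by (rule card_UNIV_bit)
  ultimately have "card V = 2 ^ card B"
    using B(1) by (simp add: card_PiE)
  moreover have "W.dim = card B"
    using W.dim_basis[OF B] .
  ultimately show ?thesis
    by (simp add: F2_dim_def)
qed

lemma F2_dim_eq_iff: "bit_subspace n V \<Longrightarrow> F2_dim n V = d \<longleftrightarrow> card V = 2 ^ d"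
  by (simp add: card_bit_subspace_dim)

lemma bit_subspace_finite: "bit_subspace n V \<Longrightarrow> finite V"
  using finite_subset[OF _ finite_carrier_vec_bit] by (auto simp: bit_subspace_def)

lemma bit_subspace_card_pos: "bit_subspace n V \<Longrightarrow> card V > 0"
  by (auto simp: bit_subspace_finite card_gt_0_iff bit_subspace_def)

lemma bit_subspace_carrier: "bit_subspace n (carrier_vec n)"
  by (auto simp: bit_subspace_def)

lemma bit_subspace_zero: "bit_subspace n {0\<^sub>v n}"
  by (auto simp: bit_subspace_def)

lemma bit_subspace_Int: "bit_subspace n V \<Longrightarrow> bit_subspace n W \<Longrightarrow> bit_subspace n (V \<inter> W)"
  by (auto simp: bit_subspace_def)

lemma bit_subspaceD:
  assumes "bit_subspace n V"
  shows "x \<in> V \<Longrightarrow> x \<in> carrier_vec n" "0\<^sub>v n \<in> V" "x \<in> V \<Longrightarrow> y \<in> V \<Longrightarrow> x + y \<in> V"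
  using assms by (auto simp: bit_subspace_def)

section \<open>Sums of subspaces and adjunction of a single vector\<close>

definition ssum :: "bvec set \<Rightarrow> bvec set \<Rightarrow> bvec set" where
  "ssum A B = (\<lambda>(a, b). a + b) ` (A \<times> B)"

lemma ssumI: "a \<in> A \<Longrightarrow> b \<in> B \<Longrightarrow> a + b \<in> ssum A B"
  by (force simp: ssum_def)

lemma ssumE:
  assumes "x \<in> ssum A B"
  obtains a b where "a \<in> A" "b \<in> B" "x = a + b"
  using assms by (auto simp: ssum_def)

lemma vec_add_swap:
  fixes a b c d :: bvec
  assumes "a \<in> carrier_vec n" "b \<in> carrier_vec n" "c \<in> carrier_vec n" "d \<in> carrier_vec n"
  shows "(a + b) + (c + d) = (a + c) + (b + d)"
  using assms by (intro eq_vecI) (auto simp: ac_simps)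

lemma bit_subspace_ssum:
  assumes A: "bit_subspace n A" and B: "bit_subspace n B"
  shows "bit_subspace n (ssum A B)"
proof -
  have "x + y \<in> ssum A B" if xy: "x \<in> ssum A B" "y \<in> ssum A B" for x y
  proof -
    obtain a b c d where *: "a \<in> A" "c \<in> A" "b \<in> B" "d \<in> B" "x = a + b" "y = c + d"
      using xy unfolding ssum_def by auto
    have "x + y = (a + c) + (b + d)"
      unfolding *(5,6)
      by (rule vec_add_swap[of _ n]) (use * bit_subspaceD(1)[OF A] bit_subspaceD(1)[OF B] in auto)
    then show ?thesis
      using * A B by (auto simp: ssum_def bit_subspace_def)
  qed
  moreover have "0\<^sub>v n \<in> ssum A B"
    using ssumI[OF bit_subspaceD(2)[OF A] bit_subspaceD(2)[OF B]] by simp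
  moreover have "ssum A B \<subseteq> carrier_vec n"
    using bit_subspaceD(1)[OF A] bit_subspaceD(1)[OF B] by (auto simp: ssum_def)
  ultimately show ?thesis
    by (auto simp: bit_subspace_def)
qed

lemma ssum_upper1:
  assumes A: "bit_subspace n A" and B: "bit_subspace n B"
  shows "A \<subseteq> ssum A B"
proof
  fix x assume x: "x \<in> A"
  then show "x \<in> ssum A B"
    using ssumI[OF x bit_subspaceD(2)[OF B]] bit_subspaceD(1)[OF A x] by simp
qed

lemma ssum_upper2:
  assumes A: "bit_subspace n A" and B: "bit_subspace n B"
  shows "B \<subseteq> ssum A B"
proof
  fix x assume x: "x \<in> B"
  then show "x \<in> ssum A B"
    using ssumI[OF bit_subspaceD(2)[OF A] x] bit_subspaceD(1)[OF B x] by simp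
qed

lemma ssum_least: "bit_subspace n V \<Longrightarrow> A \<subseteq> V \<Longrightarrow> B \<subseteq> V \<Longrightarrow> ssum A B \<subseteq> V"
  by (auto simp: ssum_def intro: bit_subspaceD(3))

text \<open>In characteristic two \<open>a + b = c + d\<close> amounts to
  \<open>a + c = b + d\<close>, an element of both \<open>A\<close> and \<open>B\<close>. A trivial
  intersection therefore makes the decomposition unique.\<close>

lemma card_ssum:
  assumes A: "bit_subspace n A" and B: "bit_subspace n B" and AB: "A \<inter> B = {0\<^sub>v n}"
  shows "card (ssum A B) = card A * card B"
proof -
  have "inj_on (\<lambda>(a, b). a + b) (A \<times> B)"
  proof (rule inj_onI, clarify)
    fix a b c d assume *: "a \<in> A" "c \<in> A" "b \<in> B" "d \<in> B" "a + b = c + d"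
    then have car: "a \<in> carrier_vec n" "b \<in> carrier_vec n" "c \<in> carrier_vec n" "d \<in> carrier_vec n"
      using A B by (auto simp: bit_subspace_def)
    have "(a + c) + (b + d) = (a + b) + (c + d)"
      using vec_add_swap[of a n c b d] car by blast
    also have "\<dots> = 0\<^sub>v n"
      using car *(5) by (metis add_carrier_vec vec_add_self)
    finally have "(a + c) + (b + d) = 0\<^sub>v n" .
    then have "a + c = b + d"
      using car by (simp only: vec_add_eq_zero_iff add_carrier_vec)
    moreover have "a + c \<in> A" "b + d \<in> B"
      using * A B by (auto simp: bit_subspace_def)
    ultimately have "a + c = 0\<^sub>v n" "b + d = 0\<^sub>v n"
      using AB by auto
    then show "a = c \<and> b = d"
      using car by (simp only: vec_add_eq_zero_iff)
  qed
  then show ?thesis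
    by (simp add: ssum_def card_image card_cartesian_product)
qed

text \<open>One link in a chain of subspaces. The counts of zooms, the extension of isomorphisms and
  the choice of generators all proceed by such links, each of which doubles the cardinality.\<close>

definition adjoin :: "nat \<Rightarrow> bvec \<Rightarrow> bvec set \<Rightarrow> bvec set" where
  "adjoin n a A = ssum A {0\<^sub>v n, a}"

lemma bit_subspace_line: "a \<in> carrier_vec n \<Longrightarrow> bit_subspace n {0\<^sub>v n, a}"
  by (auto simp: bit_subspace_def vec_add_self)

lemma bit_subspace_adjoin: "bit_subspace n A \<Longrightarrow> a \<in> carrier_vec n \<Longrightarrow> bit_subspace n (adjoin n a A)"
  unfolding adjoin_def by (intro bit_subspace_ssum bit_subspace_line)

lemma card_adjoin:
  assumes "bit_subspace n A" "a \<in> carrier_vec n" "a \<notin> A"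
  shows "card (adjoin n a A) = 2 * card A"
proof -
  have "a \<noteq> 0\<^sub>v n" "A \<inter> {0\<^sub>v n, a} = {0\<^sub>v n}"
    using assms by (auto simp: bit_subspace_def)
  then show ?thesis
    using card_ssum[OF assms(1) bit_subspace_line[OF assms(2)]] by (simp add: adjoin_def)
qed

lemma adjoin_least: "bit_subspace n V \<Longrightarrow> A \<subseteq> V \<Longrightarrow> a \<in> V \<Longrightarrow> adjoin n a A \<subseteq> V"
  unfolding adjoin_def by (rule ssum_least) (auto simp: bit_subspace_def)

lemma adjoin_upper: "bit_subspace n A \<Longrightarrow> a \<in> carrier_vec n \<Longrightarrow> A \<subseteq> adjoin n a A"
  unfolding adjoin_def using ssum_upper1 bit_subspace_line by blast

lemma in_adjoin: "bit_subspace n A \<Longrightarrow> a \<in> carrier_vec n \<Longrightarrow> a \<in> adjoin n a A"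
  unfolding adjoin_def using ssum_upper2[OF _ bit_subspace_line] by blast

lemma adjoin_subset_iff:
  assumes "bit_subspace n A" "a \<in> carrier_vec n" "bit_subspace n V"
  shows "adjoin n a A \<subseteq> V \<longleftrightarrow> A \<subseteq> V \<and> a \<in> V"
proof
  show "A \<subseteq> V \<and> a \<in> V" if "adjoin n a A \<subseteq> V"
    using adjoin_upper[OF assms(1,2)] in_adjoin[OF assms(1,2)] that by (meson subset_iff)
qed (simp add: adjoin_least[OF assms(3)])

lemma adjoin_eq:
  assumes "bit_subspace n A"
  shows "adjoin n a A = A \<union> (\<lambda>x. x + a) ` A"
proof -
  have "x + 0\<^sub>v n = x" if "x \<in> A" for x
    using assms that by (auto simp: bit_subspace_def)
  then have "(\<lambda>x. x + 0\<^sub>v n) ` A = A"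
    by simp
  moreover have "ssum A {0\<^sub>v n, a} = (\<lambda>x. x + 0\<^sub>v n) ` A \<union> (\<lambda>x. x + a) ` A"
    by (auto simp: ssum_def)
  ultimately show ?thesis
    by (simp add: adjoin_def)
qed

lemma adjoin_maximal:
  assumes A: "bit_subspace n A" and V: "bit_subspace n V" and "A \<subseteq> V" "card V = 2 * card A" "a \<in> V" "a \<notin> A"
  shows "adjoin n a A = V"
proof (rule card_subset_eq)
  show "finite V" using V by (rule bit_subspace_finite)
  show "adjoin n a A \<subseteq> V" using assms by (intro adjoin_least)
  show "card (adjoin n a A) = card V"
    using card_adjoin[OF A] V assms by (auto simp: bit_subspace_def)
qed

section \<open>Counting the subspaces of a zoom\<close>

lemma mem_grassmann_verts: "V \<in> grassmann_verts l n \<longleftrightarrow> bit_subspace n V \<and> card V = 2 ^ l"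
  using F2_dim_eq_iff by (auto simp: grassmann_verts_def F2_subspace_iff)

lemma mem_zoom: "V \<in> zoom l n Q W \<longleftrightarrow> bit_subspace n V \<and> card V = 2 ^ l \<and> Q \<subseteq> V \<and> V \<subseteq> W"
  by (auto simp: zoom_def mem_grassmann_verts)

lemma finite_grassmann_verts: "finite (grassmann_verts l n)"
proof (rule finite_subset)
  show "grassmann_verts l n \<subseteq> Pow (carrier_vec n)"
    by (auto simp: mem_grassmann_verts bit_subspace_def)
qed simp

lemma finite_zoom: "finite (zoom l n Q W)"
  using finite_grassmann_verts by (auto simp: zoom_def)

lemma zoom_self:
  assumes "bit_subspace n Q" "Q \<subseteq> W" "card Q = 2 ^ l"
  shows "zoom l n Q W = {Q}"
proof -
  have "V = Q" if "V \<in> zoom l n Q W" for V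
    using that assms card_subset_eq[of V Q] bit_subspace_finite[of n V] by (auto simp: mem_zoom)
  moreover have "Q \<in> zoom l n Q W"
    using assms by (auto simp: mem_zoom)
  ultimately show ?thesis
    by blast
qed

text \<open>Both sides count the pairs \<open>(V, v)\<close> with \<open>V\<close> in
  \<open>A\<close> and \<open>v\<close> in \<open>V - Q\<close>. Fixing \<open>v\<close> first
  reduces a count over \<open>Q\<close> to one over \<open>adjoin n v Q\<close>. The family
  \<open>A\<close> is arbitrary so that the whole zoom and its complements of a fixed subspace are
  covered alike.\<close>

lemma zoom_double_count:
  assumes Q: "bit_subspace n Q" "card Q = 2 ^ q" and W: "bit_subspace n W"
    and A: "A \<subseteq> zoom l n Q W"
  shows "real (card A) * (2 ^ l - 2 ^ q) = (\<Sum>v\<in>W - Q. real (card {V \<in> A. v \<in> V}))"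
proof -
  have finA: "finite A" and finW: "finite (W - Q)"
    using A finite_zoom finite_subset bit_subspace_finite[OF W] by blast+
  have *: "real (card {v \<in> W - Q. v \<in> V}) = 2 ^ l - 2 ^ q" if "V \<in> A" for V
  proof -
    have V: "bit_subspace n V" "card V = 2 ^ l" "Q \<subseteq> V" "V \<subseteq> W"
      using mem_zoom that A by blast+
    have "{v \<in> W - Q. v \<in> V} = V - Q"
      using V by auto
    then show ?thesis
      using V Q card_mono[OF bit_subspace_finite[OF V(1)] V(3)] bit_subspace_finite[OF Q(1)]
      by (simp add: card_Diff_subset of_nat_diff)
  qed
  have "(\<Sum>v\<in>W - Q. real (card {V \<in> A. v \<in> V})) = (\<Sum>v\<in>W - Q. \<Sum>V\<in>A. if v \<in> V then 1 else 0)"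
    using finA by (simp add: sum.If_cases Int_def)
  also have "\<dots> = (\<Sum>V\<in>A. \<Sum>v\<in>W - Q. if v \<in> V then 1 else 0)"
    by (rule sum.swap)
  also have "\<dots> = (\<Sum>V\<in>A. real (card {v \<in> W - Q. v \<in> V}))"
    using finW by (simp add: sum.If_cases Int_def)
  also have "\<dots> = real (card A) * (2 ^ l - 2 ^ q)"
    using * by simp
  finally show ?thesis
    by simp
qed

lemma zoom_adjoin:
  assumes "bit_subspace n Q" "v \<in> carrier_vec n"
  shows "{V \<in> zoom l n Q W. v \<in> V} = zoom l n (adjoin n v Q) W"
proof (rule Set.set_eqI)
  show "V \<in> {V \<in> zoom l n Q W. v \<in> V} \<longleftrightarrow> V \<in> zoom l n (adjoin n v Q) W" for V
    unfolding mem_Collect_eq mem_zoom using adjoin_subset_iff[OF assms, of V] by blast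
qed

text \<open>The probability that a uniform \<open>k\<close> by \<open>k\<close> binary matrix is
  invertible; it bounds how far a Gaussian binomial coefficient exceeds its leading power of
  two.\<close>

definition half_product :: "nat \<Rightarrow> real" where
  "half_product k = (\<Prod>j = 1..k. 1 - (1/2) ^ j)"

lemma half_product_Suc: "half_product (Suc k) = half_product k * (1 - (1/2) ^ Suc k)"
  by (simp add: half_product_def)

lemma half_product_pos: "half_product k > 0"
  unfolding half_product_def
  by (intro prod_pos) (auto simp: power_less_one_iff)

text \<open>The bare bound 1/4 is not inductive, since every further factor is below 1. The extra
  summand absorbs the loss, and for \<open>k = 1\<close> the bound is attained.\<close>

lemma half_product_ge:
  assumes "k \<ge> 1"
  shows "half_product k \<ge> 1/4 + (1/2) ^ Suc k"
  using assms
proof (induction k rule: dec_induct)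
  case base
  show ?case by (simp add: half_product_def)
next
  case (step k)
  define h :: real where "h = (1/2) ^ Suc k"
  have h: "0 \<le> h" "h \<le> 1/4"
    using step.hyps power_decreasing[of 2 "Suc k" "1/2::real"] by (auto simp: h_def power2_eq_square)
  \<comment> \<open>Expanding \<open>(1/4 + h) * (1 - h)\<close>, the induction step needs exactly
    \<open>h * h\<close> at most \<open>h/4\<close>; this holds since \<open>k\<close> is at least
    1.\<close>
  have "h * h \<le> h * (1/4)"
    using h by (intro mult_left_mono)
  then have "1/4 + h/2 \<le> (1/4 + h) * (1 - h)"
    by (simp add: field_simps)
  also have "\<dots> \<le> half_product k * (1 - h)"
    using step.IH h by (intro mult_right_mono) (auto simp: h_def)
  finally show ?case
    by (simp add: half_product_Suc h_def)
qed

lemma half_product_ge_quarter: "half_product k \<ge> 1/4"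
proof (cases k)
  case (Suc j)
  have "(1/2::real) ^ Suc k \<ge> 0" by simp
  then show ?thesis
    using half_product_ge[of k] Suc by linarith
qed (simp add: half_product_def)

text \<open>The left cardinality is the Gaussian binomial coefficient of \<open>w - q\<close> over
  \<open>l - q\<close>. Choosing a vector of \<open>W - Q\<close> to adjoin lowers
  \<open>l - q\<close> by one, and double counting divides by \<open>2^l - 2^q\<close>.\<close>

lemma card_zoom_le:
  assumes "bit_subspace n Q" "bit_subspace n W" "card Q = 2 ^ q" "card W = 2 ^ w" "Q \<subseteq> W" "q \<le> l" "l \<le> w"
  shows "real (card (zoom l n Q W)) * half_product (l - q) \<le> 2 ^ ((w - l) * (l - q))"
  using assms
proof (induction "l - q" arbitrary: Q q)
  case 0
  then have "zoom l n Q W = {Q}"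
    by (intro zoom_self) auto
  then show ?case
    using 0 by (simp add: half_product_def)
next
  case (Suc k)
  note Q = Suc.prems
  have lq: "l - q = Suc k" "l = q + Suc k"
    using Suc.hyps(2) by auto
  have IH: "real (card (zoom l n (adjoin n v Q) W)) \<le> 2 ^ ((w - l) * k) / half_product k"
    if v: "v \<in> W - Q" for v
  proof -
    have vc: "v \<in> carrier_vec n"
      using v bit_subspaceD(1)[OF Q(2)] by blast
    have "real (card (zoom l n (adjoin n v Q) W)) * half_product (l - Suc q) \<le> 2 ^ ((w - l) * (l - Suc q))"
      using Q v vc lq
      by (intro Suc.hyps(1) bit_subspace_adjoin adjoin_least) (auto simp: card_adjoin)
    then show ?thesis
      using lq half_product_pos[of k] by (simp add: field_simps)
  qed
  let ?z = "real (card (zoom l n Q W))"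
  have "?z * (2 ^ l - 2 ^ q) = (\<Sum>v\<in>W - Q. real (card {V \<in> zoom l n Q W. v \<in> V}))"
    by (rule zoom_double_count[OF Q(1,3,2)]) simp
  also have "\<dots> = (\<Sum>v\<in>W - Q. real (card (zoom l n (adjoin n v Q) W)))"
    using bit_subspaceD(1)[OF Q(2)] by (intro sum.cong refl) (auto simp: zoom_adjoin[OF Q(1)])
  also have "\<dots> \<le> (\<Sum>v\<in>W - Q. 2 ^ ((w - l) * k) / half_product k)"
    by (intro sum_mono IH)
  also have "\<dots> = real (card (W - Q)) * (2 ^ ((w - l) * k) / half_product k)"
    by simp
  also have "\<dots> \<le> 2 ^ w * (2 ^ ((w - l) * k) / half_product k)"
    using Q(4) card_mono[OF bit_subspace_finite[OF Q(2)], of "W - Q"] half_product_pos[of k]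
    by (intro mult_right_mono) (auto simp: less_imp_le simp flip: of_nat_le_iff)
  finally have "?z * (2 ^ l - 2 ^ q) * half_product k \<le> 2 ^ w * 2 ^ ((w - l) * k)"
    using half_product_pos[of k] by (simp add: field_simps)
  \<comment> \<open>Division by \<open>2^l - 2^q\<close> leaves \<open>1 - (1/2)^(k+1)\<close>, the
    next factor of \<open>half_product\<close>.\<close>
  moreover have "(2::real) ^ l - 2 ^ q = 2 ^ l * (1 - (1/2) ^ Suc k)"
    by (simp add: lq(2) power_add power_divide field_simps)
  moreover have "(2::real) ^ w = 2 ^ l * 2 ^ (w - l)"
    using Q(7) by (simp flip: power_add)
  ultimately have "2 ^ l * (?z * half_product (Suc k)) \<le> 2 ^ l * 2 ^ ((w - l) * Suc k)"
    by (simp add: half_product_Suc power_add mult_ac)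
  then show ?case
    using lq by simp
qed

lemma card_zoom_le_4:
  assumes "bit_subspace n Q" "bit_subspace n W" "card Q = 2 ^ q" "card W = 2 ^ w" "Q \<subseteq> W" "q \<le> l" "l \<le> w"
  shows "real (card (zoom l n Q W)) \<le> 4 * 2 ^ ((w - l) * (l - q))"
proof -
  have "real (card (zoom l n Q W)) * (1/4) \<le> real (card (zoom l n Q W)) * half_product (l - q)"
    using half_product_ge_quarter by (intro mult_left_mono) auto
  then show ?thesis
    using card_zoom_le[OF assms] by linarith
qed

text \<open>If \<open>x + v\<close> were in \<open>U\<close> for some \<open>x\<close> in
  \<open>Q\<close>, then \<open>v = x + (x + v)\<close> would lie in \<open>Q + U\<close>.\<close>

lemma adjoin_Int_trivial:
  assumes Q: "bit_subspace n Q" and U: "bit_subspace n U" and QU: "Q \<inter> U = {0\<^sub>v n}"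
    and v: "v \<in> carrier_vec n" "v \<notin> ssum Q U"
  shows "adjoin n v Q \<inter> U = {0\<^sub>v n}"
proof -
  have False if x: "x \<in> Q" "x + v \<in> U" for x
  proof -
    have "x + (x + v) = v"
      using vec_add_self_left v(1) bit_subspaceD(1)[OF Q x(1)] by blast
    then show False
      using ssumI[OF x] v(2) by metis
  qed
  then show ?thesis
    using QU bit_subspaceD(2)[OF U] unfolding adjoin_eq[OF Q] by auto
qed

text \<open>The complements of \<open>U\<close> in \<open>W\<close> that contain \<open>Q\<close>
  form an affine space over the linear maps from \<open>W / (Q + U)\<close> to \<open>U\<close>,
  which explains the exact power of two. The count follows the induction for
  \<open>card_zoom_le\<close>, but here the factor \<open>2^l - 2^q\<close> cancels without
  loss.\<close>

lemma card_zoom_complement: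
  assumes "bit_subspace n Q" "bit_subspace n W" "bit_subspace n U" "card Q = 2 ^ q" "card W = 2 ^ w" "Q \<subseteq> W" "U \<subseteq> W"
    and "Q \<inter> U = {0\<^sub>v n}" "card U = 2 ^ (w - l)" "q \<le> l" "l \<le> w"
  shows "real (card {V \<in> zoom l n Q W. V \<inter> U = {0\<^sub>v n}}) = 2 ^ ((w - l) * (l - q))"
  using assms
proof (induction "l - q" arbitrary: Q q)
  case 0
  then have "zoom l n Q W = {Q}"
    by (intro zoom_self) auto
  then have "{V \<in> zoom l n Q W. V \<inter> U = {0\<^sub>v n}} = {Q}"
    using 0 by auto
  then show ?case
    using 0 by simp
next
  case (Suc k)
  note Q = Suc.prems
  have lq: "l - q = Suc k" "l = q + Suc k"
    using Suc.hyps(2) by auto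
  let ?T = "\<lambda>Q. {V \<in> zoom l n Q W. V \<inter> U = {0\<^sub>v n}}"
  have QW: "ssum Q U \<subseteq> W" "Q \<subseteq> ssum Q U"
    using Q ssum_least ssum_upper1 by auto
  have cardQU: "card (ssum Q U) = 2 ^ (q + (w - l))"
    using card_ssum[OF Q(1,3,8)] Q by (simp only: power_add)
  have eq: "{V \<in> ?T Q. v \<in> V} = ?T (adjoin n v Q)" if "v \<in> W - Q" for v
  proof -
    have "v \<in> carrier_vec n"
      using that bit_subspaceD(1)[OF Q(2)] by blast
    then show ?thesis
      using zoom_adjoin[OF Q(1), of v l W] by auto
  qed
  have IH: "real (card {V \<in> ?T Q. v \<in> V}) = (if v \<in> ssum Q U then 0 else 2 ^ ((w - l) * k))"
    if v: "v \<in> W - Q" for v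
  proof (cases "v \<in> ssum Q U")
    case False
    have vc: "v \<in> carrier_vec n"
      using v bit_subspaceD(1)[OF Q(2)] by blast
    have "real (card (?T (adjoin n v Q))) = 2 ^ ((w - l) * (l - Suc q))"
      using Q v vc lq False
      by (intro Suc.hyps(1) bit_subspace_adjoin adjoin_least adjoin_Int_trivial) (auto simp: card_adjoin)
    then show ?thesis
      using eq[OF v] lq False by simp
  next
    case True
    \<comment> \<open>Vectors of \<open>Q + U\<close> outside \<open>Q\<close> lie in no admissible
      \<open>V\<close>: with \<open>a\<close> and \<open>a + b\<close> in \<open>V\<close>, also
      \<open>b\<close> is in \<open>V \<inter> U\<close>, so it vanishes and \<open>v\<close> is in
      \<open>Q\<close>.\<close>
    then obtain a b where ab: "a \<in> Q" "b \<in> U" "v = a + b"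
      by (rule ssumE)
    have "False" if V: "V \<in> ?T Q" "v \<in> V" for V
    proof -
      have Vs: "bit_subspace n V" "Q \<subseteq> V"
        using V by (auto simp: mem_zoom)
      have car: "a \<in> carrier_vec n" "b \<in> carrier_vec n"
        using ab bit_subspaceD(1)[OF Q(1)] bit_subspaceD(1)[OF Q(3)] by auto
      have "a + v \<in> V"
        using Vs V ab by (intro bit_subspaceD(3)[OF Vs(1)]) auto
      then have "b \<in> V"
        using vec_add_self_left[OF car] ab by simp
      then have "b = 0\<^sub>v n"
        using ab V by auto
      then show False
        using ab v car by simp
    qed
    then have "{V \<in> ?T Q. v \<in> V} = {}"
      by blast
    then have "card {V \<in> ?T Q. v \<in> V} = 0"
      by (simp only: card.empty)
    then show ?thesis
      using True by (simp only: if_True of_nat_0)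
  qed
  let ?z = "real (card (?T Q))"
  have "?z * (2 ^ l - 2 ^ q) = (\<Sum>v\<in>W - Q. real (card {V \<in> ?T Q. v \<in> V}))"
    by (rule zoom_double_count[OF Q(1,4,2)]) auto
  also have "\<dots> = (\<Sum>v\<in>W - Q. if v \<in> ssum Q U then 0 else 2 ^ ((w - l) * k))"
    by (intro sum.cong refl IH)
  also have "\<dots> = (\<Sum>v\<in>W - ssum Q U. 2 ^ ((w - l) * k))"
    using QW bit_subspace_finite[OF Q(2)] by (intro sum.mono_neutral_cong_right) auto
  also have "\<dots> = real (card (W - ssum Q U)) * 2 ^ ((w - l) * k)"
    by simp
  also have "real (card (W - ssum Q U)) = 2 ^ w - 2 ^ (q + (w - l))"
    using QW Q cardQU card_mono[OF bit_subspace_finite[OF Q(2)] QW(1)] finite_subset[OF QW(1) bit_subspace_finite[OF Q(2)]]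
    by (simp add: card_Diff_subset of_nat_diff)
  also have "(2::real) ^ w - 2 ^ (q + (w - l)) = 2 ^ (w - l) * (2 ^ l - 2 ^ q)"
    using Q by (simp add: power_add[symmetric] right_diff_distrib algebra_simps)
  finally have "?z * (2 ^ l - 2 ^ q) = 2 ^ ((w - l) * Suc k) * (2 ^ l - 2 ^ q)"
    by (simp add: power_add)
  moreover have "(2::real) ^ l - 2 ^ q \<noteq> 0"
    using lq power_strict_increasing[of q l "2::real"] by simp
  ultimately show ?case
    using lq by simp
qed

section \<open>Automorphisms and transitivity on edges\<close>

lemma vec_add_right_comm:
  fixes x y z :: bvec
  assumes "x \<in> carrier_vec n" "y \<in> carrier_vec n" "z \<in> carrier_vec n"
  shows "(x + y) + z = (x + z) + y"
  using assms by (intro eq_vecI) (auto simp: ac_simps)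

definition additive_on :: "bvec set \<Rightarrow> (bvec \<Rightarrow> bvec) \<Rightarrow> bool" where
  "additive_on A g \<longleftrightarrow> (\<forall>x\<in>A. \<forall>y\<in>A. g (x + y) = g x + g y)"

definition bit_iso :: "nat \<Rightarrow> (bvec \<Rightarrow> bvec) \<Rightarrow> bvec set \<Rightarrow> bvec set \<Rightarrow> bool" where
  "bit_iso n g A B \<longleftrightarrow> bit_subspace n A \<and> bit_subspace n B \<and> additive_on A g \<and> bij_betw g A B"

lemma additive_on_zero:
  assumes "additive_on A g" "bit_subspace n A" "g ` A \<subseteq> carrier_vec m"
  shows "g (0\<^sub>v n) = 0\<^sub>v m"
proof -
  have "g (0\<^sub>v n + 0\<^sub>v n) = g (0\<^sub>v n) + g (0\<^sub>v n)"
    using assms(1) bit_subspaceD(2)[OF assms(2)] unfolding additive_on_def by blast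
  moreover have "g (0\<^sub>v n) \<in> carrier_vec m"
    using assms bit_subspaceD(2) by blast
  ultimately show ?thesis
    by (simp add: vec_add_self)
qed

lemma additive_on_subset: "additive_on B g \<Longrightarrow> A \<subseteq> B \<Longrightarrow> additive_on A g"
  by (auto simp: additive_on_def)

lemma bit_subspace_image:
  assumes "additive_on A g" "bit_subspace n A" "g ` A \<subseteq> carrier_vec m"
  shows "bit_subspace m (g ` A)"
proof -
  have "g x + g y \<in> g ` A" if "x \<in> A" "y \<in> A" for x y
  proof -
    have "g x + g y = g (x + y)"
      using assms(1) that by (auto simp: additive_on_def)
    then show ?thesis
      using bit_subspaceD(3)[OF assms(2) that] by simp
  qed
  then show ?thesis
    using assms additive_on_zero[OF assms] bit_subspaceD(2)[OF assms(2)] unfolding bit_subspace_def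
    by (metis (no_types, lifting) imageE image_eqI)
qed

text \<open>The value on the new vector may be prescribed freely outside \<open>B\<close>; this
  freedom later lets one automorphism control both ends of an edge.\<close>

lemma bit_iso_extend_step:
  assumes g: "bit_iso n g A B"
    and a: "a \<in> carrier_vec n" "a \<notin> A" and b: "b \<in> carrier_vec n" "b \<notin> B"
  obtains h where "bit_iso n h (adjoin n a A) (adjoin n b B)" "\<forall>x\<in>A. h x = g x" "h a = b"
proof -
  have A: "bit_subspace n A" and B: "bit_subspace n B" and add: "additive_on A g" and bij: "bij_betw g A B"
    using g by (auto simp: bit_iso_def)
  have gB: "g x \<in> B" if "x \<in> A" for x
    using bij that by (auto simp: bij_betw_def)
  have gc: "g x \<in> carrier_vec n" if "x \<in> A" for x
    using gB[OF that] bit_subspaceD(1)[OF B] by blast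
  have Ac: "x \<in> carrier_vec n" if "x \<in> A" for x
    using that bit_subspaceD(1)[OF A] by blast
  \<comment> \<open>Off \<open>A\<close> the argument has the form \<open>z + a\<close>, and adding
    \<open>a\<close> again recovers \<open>z\<close>.\<close>
  define h where "h x = (if x \<in> A then g x else g (x + a) + b)" for x
  have cancel: "(x + a) + a = x" if "x \<in> A" for x
    using Ac[OF that] a(1) by (simp add: vec_add_self)
  have notA: "x + a \<notin> A" if "x \<in> A" for x
  proof
    assume "x + a \<in> A"
    then have "x + (x + a) \<in> A"
      using that bit_subspaceD(3)[OF A] by blast
    then show False
      using vec_add_self_left[OF Ac[OF that] a(1)] a(2) by simp
  qed
  have h1: "h x = g x" if "x \<in> A" for x
    using that by (simp add: h_def)
  have h2: "h (x + a) = g x + b" if "x \<in> A" for x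
    using notA[OF that] cancel[OF that] by (simp add: h_def)
  have gadd: "g (x + y) = g x + g y" if "x \<in> A" "y \<in> A" for x y
    using add that by (auto simp: additive_on_def)
  have cl: "x + y \<in> A" if "x \<in> A" "y \<in> A" for x y
    using bit_subspaceD(3)[OF A] that by blast
  have "additive_on (adjoin n a A) h"
    unfolding additive_on_def
  proof (intro ballI)
    fix x y assume "x \<in> adjoin n a A" "y \<in> adjoin n a A"
    then consider "x \<in> A" "y \<in> A" | z where "z \<in> A" "x = z + a" "y \<in> A"
      | z where "x \<in> A" "z \<in> A" "y = z + a" | u v where "u \<in> A" "v \<in> A" "x = u + a" "y = v + a"
      by (auto simp: adjoin_eq[OF A])
    then show "h (x + y) = h x + h y"
    proof cases
      case 1
      then show ?thesis by (simp add: h1 gadd cl)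
    next
      case 2
      have "x + y = (z + y) + a"
        using vec_add_right_comm[of z n a y] 2 a Ac by simp
      moreover have "(g z + g y) + b = (g z + b) + g y"
        using vec_add_right_comm[of "g z" n "g y" b] gc[OF 2(1)] gc[OF 2(3)] b by simp
      ultimately show ?thesis
        using 2 by (simp add: h1 h2 gadd cl)
    next
      case 3
      have "x + y = (x + z) + a"
        using 3 a Ac assoc_add_vec[of x n z a] by simp
      moreover have "(g x + g z) + b = g x + (g z + b)"
        using gc[OF 3(1)] gc[OF 3(2)] b by simp
      ultimately show ?thesis
        using 3 h1[OF 3(1)] h2[OF 3(2)] h2[OF cl[OF 3(1,2)]] gadd[OF 3(1,2)] by simp
    next
      case 4
      have "x + y = (u + v) + (a + a)"
        unfolding 4 using vec_add_swap[of u n a v a] 4 Ac a by simp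
      then have "x + y = u + v"
        using 4 Ac a by (simp add: vec_add_self)
      moreover have "(g u + b) + (g v + b) = (g u + g v) + (b + b)"
        using vec_add_swap[of "g u" n b "g v" b] 4 gc b by simp
      then have "(g u + b) + (g v + b) = g u + g v"
        using gc[OF 4(1)] gc[OF 4(2)] b by (simp add: vec_add_self)
      ultimately show ?thesis
        using 4 h1[OF cl[OF 4(1,2)]] h2[OF 4(1)] h2[OF 4(2)] gadd[OF 4(1,2)] by simp
    qed
  qed
  moreover have img: "h ` adjoin n a A = adjoin n b B"
  proof -
    have "h ` A = B"
      using bij h1 by (auto simp: bij_betw_def)
    moreover have "h ` (\<lambda>x. x + a) ` A = (\<lambda>y. y + b) ` g ` A"
      using h2 by (simp add: image_image)
    moreover have "g ` A = B"
      using bij by (simp add: bij_betw_def)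
    ultimately show ?thesis
      by (simp add: adjoin_eq[OF A] adjoin_eq[OF B] image_Un)
  qed
  \<comment> \<open>Injectivity comes for free: \<open>h\<close> maps onto a finite set of the same
    cardinality.\<close>
  have "card A = card B"
    using bij by (rule bij_betw_same_card)
  then have "card (adjoin n b B) = card (adjoin n a A)"
    using card_adjoin[OF A a] card_adjoin[OF B b] by simp
  then have "inj_on h (adjoin n a A)"
    using img bit_subspace_finite[OF bit_subspace_adjoin[OF A a(1)]] by (simp add: eq_card_imp_inj_on)
  moreover have "h a = b"
  proof -
    have "h (0\<^sub>v n + a) = g (0\<^sub>v n) + b"
      using h2 bit_subspaceD(2)[OF A] by blast
    moreover have "g (0\<^sub>v n) = 0\<^sub>v n"
      using additive_on_zero[OF add A] gc by blast
    ultimately show ?thesis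
      using a b by simp
  qed
  ultimately show ?thesis
    using that[of h] img h1 bit_subspace_adjoin[OF A a(1)] bit_subspace_adjoin[OF B b(1)]
    by (simp add: bit_iso_def bij_betw_def)
qed

text \<open>Equal cardinalities guarantee that the two chains above \<open>A\<close> and
  \<open>B\<close> can be climbed in step, one vector at a time.\<close>

lemma bit_iso_extend:
  assumes "bit_iso n g A B" "bit_subspace n A2" "bit_subspace n B2" "A \<subseteq> A2" "B \<subseteq> B2" "card A2 = card B2"
  shows "\<exists>h. bit_iso n h A2 B2 \<and> (\<forall>x\<in>A. h x = g x)"
  using assms
proof (induction "card A2 - card A" arbitrary: A B g rule: less_induct)
  case less
  have A: "bit_subspace n A" "bit_subspace n B" and AB: "card A = card B"
    using less.prems by (auto simp: bit_iso_def bij_betw_same_card)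
  show ?case
  proof (cases "A = A2")
    case True
    then have "B = B2"
      using less.prems AB bit_subspace_finite card_subset_eq by metis
    then show ?thesis
      using True less.prems by blast
  next
    case False
    then have "B \<noteq> B2"
      using less.prems AB bit_subspace_finite card_subset_eq by metis
    then obtain a b where a: "a \<in> A2" "a \<notin> A" and b: "b \<in> B2" "b \<notin> B"
      using False less.prems by blast
    have ac: "a \<in> carrier_vec n" "b \<in> carrier_vec n"
      using a b less.prems bit_subspaceD(1) by blast+
    obtain h where h: "bit_iso n h (adjoin n a A) (adjoin n b B)" "\<forall>x\<in>A. h x = g x"
      using bit_iso_extend_step[OF less.prems(1) ac(1) a(2) ac(2) b(2)] by metis
    have sub: "adjoin n a A \<subseteq> A2" "adjoin n b B \<subseteq> B2"
      by (rule adjoin_least; use a b less.prems in simp)+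
    have "card A < card (adjoin n a A)" "card (adjoin n a A) \<le> card A2"
      using card_adjoin[OF A(1) ac(1) a(2)] bit_subspace_card_pos[OF A(1)]
        card_mono[OF bit_subspace_finite[OF less.prems(2)] sub(1)] by auto
    then have "\<exists>h'. bit_iso n h' A2 B2 \<and> (\<forall>x\<in>adjoin n a A. h' x = h x)"
      by (intro less.hyps[OF _ h(1) less.prems(2,3) sub less.prems(6)]) linarith
    then show ?thesis
      using h(2) adjoin_upper[OF A(1) ac(1)] by (metis subset_iff)
  qed
qed

text \<open>Additive maps over two elements are linear, so this is the general linear group.
  Elements are permutations of the whole type that fix everything outside
  \<open>carrier_vec n\<close>; this makes the set finite and allows inverses on
  \<open>UNIV\<close>.\<close>

definition Aut :: "nat \<Rightarrow> (bvec \<Rightarrow> bvec) set" where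
  "Aut n = {g. g permutes carrier_vec n \<and> additive_on (carrier_vec n) g}"

lemma finite_Aut: "finite (Aut n)"
  by (rule finite_subset[OF _ finite_permutations[OF finite_carrier_vec_bit[of n]]])
    (auto simp: Aut_def)

lemma AutD:
  assumes "g \<in> Aut n"
  shows "g permutes carrier_vec n"
    and "x \<in> carrier_vec n \<Longrightarrow> g x \<in> carrier_vec n"
    and "x \<in> carrier_vec n \<Longrightarrow> y \<in> carrier_vec n \<Longrightarrow> g (x + y) = g x + g y"
    and "inj g"
  using assms by (auto simp: Aut_def additive_on_def permutes_in_image permutes_inj)

lemma Aut_comp:
  assumes "g \<in> Aut n" "h \<in> Aut n"
  shows "g \<circ> h \<in> Aut n"
  using assms AutD[OF assms(1)] AutD[OF assms(2)]
  by (auto simp: Aut_def additive_on_def permutes_compose)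

lemma Aut_inv:
  assumes g: "g \<in> Aut n"
  shows "inv_into UNIV g \<in> Aut n"
proof -
  have p: "g permutes carrier_vec n"
    using AutD[OF g] by blast
  have ip: "inv_into UNIV g permutes carrier_vec n"
    by (rule permutes_inv[OF p])
  have "inv_into UNIV g (x + y) = inv_into UNIV g x + inv_into UNIV g y" if "x \<in> carrier_vec n" "y \<in> carrier_vec n" for x y
  proof -
    have "g (inv_into UNIV g x + inv_into UNIV g y) = g (inv_into UNIV g x) + g (inv_into UNIV g y)"
      using that permutes_in_image[OF ip] by (intro AutD(3)[OF g]) auto
    then have "g (inv_into UNIV g x + inv_into UNIV g y) = x + y"
      using permutes_inverses[OF p] by simp
    then show ?thesis
      using permutes_inverses[OF p] by metis
  qed
  then show ?thesis
    using ip by (auto simp: Aut_def additive_on_def)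
qed

lemma Aut_image_bit_subspace:
  assumes g: "g \<in> Aut n" and V: "bit_subspace n V"
  shows "bit_subspace n (g ` V)" "card (g ` V) = card V"
proof -
  have "additive_on V g"
    using g V additive_on_subset by (auto simp: Aut_def bit_subspace_def)
  then show "bit_subspace n (g ` V)"
    using bit_subspaceD(1)[OF V] AutD(2)[OF g] by (intro bit_subspace_image[OF _ V]) auto
  show "card (g ` V) = card V"
    using AutD(4)[OF g] by (simp add: card_image inj_on_def)
qed

lemma Aut_inv_image: "g \<in> Aut n \<Longrightarrow> inv_into UNIV g ` g ` V = V" "g \<in> Aut n \<Longrightarrow> g ` inv_into UNIV g ` V = V"
  using AutD(1) permutes_inverses by (fastforce simp: image_image)+

lemma bit_iso_Aut:
  assumes g: "bit_iso n g A B"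
  obtains h where "h \<in> Aut n" "\<forall>x\<in>A. h x = g x"
proof -
  have "A \<subseteq> carrier_vec n" "B \<subseteq> carrier_vec n"
    using g by (auto simp: bit_iso_def bit_subspace_def)
  then obtain h where h: "bit_iso n h (carrier_vec n) (carrier_vec n)" "\<forall>x\<in>A. h x = g x"
    using bit_iso_extend[OF g bit_subspace_carrier bit_subspace_carrier] by blast
  define h' where "h' x = (if x \<in> carrier_vec n then h x else x)" for x
  have "bij_betw h' (carrier_vec n) (carrier_vec n)"
    using h(1) by (subst bij_betw_cong[of _ _ h]) (auto simp: h'_def bit_iso_def)
  then have "h' permutes carrier_vec n"
    by (rule bij_imp_permutes) (simp add: h'_def)
  moreover have "additive_on (carrier_vec n) h'"
    using h(1) by (auto simp: additive_on_def h'_def bit_iso_def)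
  ultimately have "h' \<in> Aut n"
    by (simp add: Aut_def)
  moreover have "\<forall>x\<in>A. h' x = g x"
    using h(2) \<open>A \<subseteq> carrier_vec n\<close> by (auto simp: h'_def)
  ultimately show ?thesis
    using that by blast
qed

lemma bit_iso_zero: "bit_iso n id {0\<^sub>v n} {0\<^sub>v n}"
  by (simp add: bit_iso_def bit_subspace_zero additive_on_def)

lemma bit_iso_exists:
  assumes "bit_subspace n A" "bit_subspace n B" "card A = card B"
  obtains g where "bit_iso n g A B"
  using bit_iso_extend[OF bit_iso_zero assms(1,2)] assms bit_subspaceD(2) by blast

lemma Aut_transitive:
  assumes "bit_subspace n A" "bit_subspace n B" "card A = card B"
  obtains g where "g \<in> Aut n" "g ` A = B"
proof -
  obtain g where g: "bit_iso n g A B"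
    using bit_iso_exists[OF assms] .
  obtain h where "h \<in> Aut n" "\<forall>x\<in>A. h x = g x"
    using bit_iso_Aut[OF g] .
  moreover from this have "h ` A = B"
    using g by (auto simp: bit_iso_def bij_betw_def)
  ultimately show ?thesis
    using that by blast
qed

lemma Aut_adjoin_image:
  assumes "g \<in> Aut n" "bit_subspace n A" "a \<in> carrier_vec n"
  shows "g ` adjoin n a A = adjoin n (g a) (g ` A)"
proof -
  have "g ` (\<lambda>x. x + a) ` A = (\<lambda>x. x + g a) ` g ` A"
    using AutD(3)[OF assms(1)] bit_subspaceD(1)[OF assms(2)] assms(3) by (auto simp: image_image)
  then show ?thesis
    using adjoin_eq[OF assms(2)] adjoin_eq[OF Aut_image_bit_subspace(1)[OF assms(1,2)]]
    by (simp add: image_Un)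
qed

text \<open>Adjacency without mention of \<open>l\<close>: the intersection is a hyperplane in both
  spaces, that is, half of each.\<close>

definition bit_adj :: "nat \<Rightarrow> bvec set \<Rightarrow> bvec set \<Rightarrow> bool" where
  "bit_adj n A B \<longleftrightarrow> bit_subspace n A \<and> bit_subspace n B \<and> card A = 2 * card (A \<inter> B) \<and> card B = 2 * card (A \<inter> B)"

text \<open>The automorphism is built along the chain \<open>A \<inter> B \<subseteq> A \<subseteq> A + B\<close>.\<close>
lemma Aut_transitive_adjacent:
  assumes AB: "bit_adj n A B" and CD: "bit_adj n C D" and card: "card A = card C"
  obtains g where "g \<in> Aut n" "g ` A = C" "g ` B = D"
proof -
  have A: "bit_subspace n A" "bit_subspace n B" "bit_subspace n (A \<inter> B)" "card A = 2 * card (A \<inter> B)" "card B = 2 * card (A \<inter> B)"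
    and C: "bit_subspace n C" "bit_subspace n D" "bit_subspace n (C \<inter> D)" "card C = 2 * card (C \<inter> D)" "card D = 2 * card (C \<inter> D)"
    using AB CD by (auto simp: bit_adj_def bit_subspace_Int)
  \<comment> \<open>The intersection is nonempty, so it is strictly smaller than its double; hence
    \<open>B\<close> has a vector outside \<open>A\<close>, and \<open>D\<close> one outside
    \<open>C\<close>.\<close>
  have "card (A \<inter> B) > 0" "card (C \<inter> D) > 0"
    using A C bit_subspace_card_pos by blast+
  then have "card (A \<inter> B) \<noteq> card B" "card (C \<inter> D) \<noteq> card D"
    using A(5) C(5) by linarith+
  then have "A \<inter> B \<noteq> B" "C \<inter> D \<noteq> D"
    by metis+
  then obtain b d where b: "b \<in> B" "b \<notin> A" and d: "d \<in> D" "d \<notin> C"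
    by blast
  have bc: "b \<in> carrier_vec n" "d \<in> carrier_vec n"
    using b d A C bit_subspaceD(1) by blast+
  obtain g1 where g1: "bit_iso n g1 (A \<inter> B) (C \<inter> D)"
    using bit_iso_exists[OF A(3) C(3)] A C card by auto
  obtain g2 where g2: "bit_iso n g2 A C" "\<forall>x\<in>A \<inter> B. g2 x = g1 x"
    using bit_iso_extend[OF g1 A(1) C(1)] card by blast
  obtain g3 where g3: "bit_iso n g3 (adjoin n b A) (adjoin n d C)" "\<forall>x\<in>A. g3 x = g2 x" "g3 b = d"
    using bit_iso_extend_step[OF g2(1) bc(1) b(2) bc(2) d(2)] .
  obtain g where g: "g \<in> Aut n" "\<forall>x\<in>adjoin n b A. g x = g3 x"
    using bit_iso_Aut[OF g3(1)] .
  have gA: "g x = g2 x" if "x \<in> A" for x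
    using that g(2) g3(2) adjoin_upper[OF A(1) bc(1)] by auto
  have "g ` A = g2 ` A"
    using gA by (intro image_cong) auto
  then have 1: "g ` A = C"
    using g2(1) by (simp add: bit_iso_def bij_betw_def)
  have "g ` (A \<inter> B) = g1 ` (A \<inter> B)"
    using gA g2(2) by (intro image_cong) auto
  then have 2: "g ` (A \<inter> B) = C \<inter> D"
    using g1 by (simp add: bit_iso_def bij_betw_def)
  have "g b = d"
    using g(2) g3(3) in_adjoin[OF A(1) bc(1)] by simp
  \<comment> \<open>Since \<open>A \<inter> B\<close> is half of \<open>B\<close>, the vector
    \<open>b\<close> completes it to \<open>B\<close>. The images of \<open>A \<inter> B\<close> and
    of \<open>b\<close> thus determine the image of \<open>B\<close>.\<close>
  moreover have "B = adjoin n b (A \<inter> B)"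
    using adjoin_maximal[OF A(3,2) Int_lower2 A(5) b(1)] b(2) by simp
  moreover have "D = adjoin n d (C \<inter> D)"
    using adjoin_maximal[OF C(3,2) Int_lower2 C(5) d(1)] d(2) by simp
  ultimately have "g ` B = D"
    using Aut_adjoin_image[OF g(1) A(3) bc(1)] 2 by simp
  then show ?thesis
    using that g(1) 1 by blast
qed

section \<open>Graphs of matrices\<close>

text \<open>If \<open>f v = 1\<close>, then adding \<open>v\<close> moves every vector with value 1
  into the kernel, so \<open>K\<close> and \<open>v\<close> together generate
  \<open>V\<close>.\<close>

lemma kernel_index_two:
  assumes V: "bit_subspace n V" and add: "\<And>x y. x \<in> V \<Longrightarrow> y \<in> V \<Longrightarrow> f (x + y) = f x + (f y :: bit)"
  defines "K \<equiv> {x \<in> V. f x = 0}"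
  shows "bit_subspace n K" and "v \<in> V \<Longrightarrow> f v \<noteq> 0 \<Longrightarrow> card V = 2 * card K"
    and "card V \<le> 2 * card K"
proof -
  have "f (0\<^sub>v n + 0\<^sub>v n) = f (0\<^sub>v n) + f (0\<^sub>v n)"
    using bit_subspaceD(2)[OF V] by (intro add)
  then have "f (0\<^sub>v n) = 0"
    by simp
  then show K: "bit_subspace n K"
    using V add by (auto simp: K_def bit_subspace_def)
  show *: "card V = 2 * card K" if v: "v \<in> V" "f v \<noteq> 0" for v
  proof -
    have vc: "v \<in> carrier_vec n"
      using bit_subspaceD(1)[OF V v(1)] .
    have "v \<notin> K"
      using v by (simp add: K_def)
    moreover have "V \<subseteq> adjoin n v K"
    proof
      fix x assume x: "x \<in> V"
      show "x \<in> adjoin n v K"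
      proof (cases "f x")
        case zero
        then have "x \<in> K"
          using x by (simp add: K_def)
        then show ?thesis
          using adjoin_upper[OF K vc] by blast
      next
        case one
        have "f (x + v) = 0"
          using one v add[OF x v(1)] by simp
        then have "x + v \<in> K"
          using bit_subspaceD(3)[OF V x v(1)] by (simp add: K_def)
        moreover have "(x + v) + v = x"
          using bit_subspaceD(1)[OF V x] vc by (simp add: vec_add_self)
        ultimately show ?thesis
          unfolding adjoin_eq[OF K] by (metis UnI2 image_eqI)
      qed
    qed
    moreover have "adjoin n v K \<subseteq> V"
      using v by (intro adjoin_least[OF V]) (auto simp: K_def)
    ultimately show ?thesis
      using card_adjoin[OF K vc] by auto
  qed
  show "card V \<le> 2 * card K"
  proof (cases "\<exists>v\<in>V. f v \<noteq> 0")
    case True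
    then show ?thesis
      using * by auto
  next
    case False
    then have "K = V"
      by (auto simp: K_def)
    then show ?thesis
      by simp
  qed
qed

lemma bit_subspace_unit_vecs:
  assumes V: "bit_subspace n V" and unit: "\<And>i. i < n \<Longrightarrow> unit_vec n i \<in> V"
  shows "V = carrier_vec n"
proof
  show "carrier_vec n \<subseteq> V"
  proof
    fix x :: bvec assume x: "x \<in> carrier_vec n"
    \<comment> \<open>Induction on the number of coordinates kept: the next coordinate contributes a
      unit vector or nothing.\<close>
    have "Matrix.vec n (\<lambda>i. if i < k then vec_index x i else 0) \<in> V" if "k \<le> n" for k
      using that
    proof (induction k)
      case 0
      have "Matrix.vec n (\<lambda>i. if i < 0 then vec_index x i else 0) = 0\<^sub>v n"
        by (intro eq_vecI) auto
      then show ?case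
        using bit_subspaceD(2)[OF V] by metis
    next
      case (Suc k)
      let ?u = "\<lambda>k. Matrix.vec n (\<lambda>i. if i < k then vec_index x i else 0)"
      have IH: "?u k \<in> V"
        using Suc by simp
      show ?case
      proof (cases "vec_index x k")
        case zero
        then have "?u (Suc k) = ?u k"
          by (intro eq_vecI) (auto simp: less_Suc_eq)
        then show ?thesis
          using IH by metis
      next
        case one
        then have "?u (Suc k) = ?u k + unit_vec n k"
          by (intro eq_vecI) (auto simp: less_Suc_eq unit_vec_def)
        then show ?thesis
          using bit_subspaceD(3)[OF V IH unit[of k]] Suc by simp
      qed
    qed
    from this[of n] have "Matrix.vec n (\<lambda>i. if i < n then vec_index x i else 0) \<in> V"
      by simp
    also have "Matrix.vec n (\<lambda>i. if i < n then vec_index x i else 0) = x"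
      using x by (intro eq_vecI) auto
    finally show "x \<in> V" .
  qed
qed (use bit_subspaceD(1)[OF V] in blast)

text \<open>The rows of \<open>M\<close> are the images of the unit vectors. The vectors on which
  \<open>f\<close> agrees with the transpose of \<open>M\<close> form a subspace containing all unit
  vectors.\<close>

lemma additive_mat:
  assumes add: "additive_on (carrier_vec l) f" and f: "f ` carrier_vec l \<subseteq> carrier_vec m"
  obtains M where "M \<in> carrier_mat l m" "\<And>x. x \<in> carrier_vec l \<Longrightarrow> f x = transpose_mat M *\<^sub>v x"
proof -
  define M where "M = Matrix.mat l m (\<lambda>(i, j). vec_index (f (unit_vec l i)) j)"
  have M: "M \<in> carrier_mat l m" "transpose_mat M \<in> carrier_mat m l"
    by (auto simp: M_def)
  let ?V = "{x \<in> carrier_vec l. f x = transpose_mat M *\<^sub>v x}"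
  have fc: "f x \<in> carrier_vec m" if "x \<in> carrier_vec l" for x
    using f that by blast
  have f0: "f (0\<^sub>v l) = 0\<^sub>v m"
    using additive_on_zero[OF add bit_subspace_carrier f] .
  have z: "transpose_mat M *\<^sub>v 0\<^sub>v l = 0\<^sub>v m"
    using M by (intro eq_vecI) auto
  have ad: "f (x + y) = transpose_mat M *\<^sub>v (x + y)" if "x \<in> ?V" "y \<in> ?V" for x y
    using that add mult_add_distrib_mat_vec[OF M(2), of x y] by (simp add: additive_on_def)
  have "bit_subspace l ?V"
    using f0 z ad by (auto simp: bit_subspace_def)
  moreover have "unit_vec l i \<in> ?V" if "i < l" for i
  proof -
    have "f (unit_vec l i) = transpose_mat M *\<^sub>v unit_vec l i"
      using that fc[of "unit_vec l i"] by (intro eq_vecI) (auto simp: M_def)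
    then show ?thesis
      by simp
  qed
  ultimately have "?V = carrier_vec l"
    by (rule bit_subspace_unit_vecs)
  then show ?thesis
    using that[OF M(1)] by blast
qed

text \<open>The row space of the block matrix \<open>(I | M)\<close>.\<close>

definition graph_space :: "bit Matrix.mat \<Rightarrow> bvec set" where
  "graph_space M = (\<lambda>x. x @\<^sub>v (transpose_mat M *\<^sub>v x)) ` carrier_vec (dim_row M)"

definition vertical :: "nat \<Rightarrow> nat \<Rightarrow> bvec set" where
  "vertical l m = (\<lambda>y. 0\<^sub>v l @\<^sub>v y) ` carrier_vec m"

lemma append_in_graph_space:
  assumes "M \<in> carrier_mat l m" "x \<in> carrier_vec l"
  shows "x @\<^sub>v y \<in> graph_space M \<longleftrightarrow> transpose_mat M *\<^sub>v x = y"
proof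
  assume "x @\<^sub>v y \<in> graph_space M"
  then obtain x' where "x' \<in> carrier_vec l" "x @\<^sub>v y = x' @\<^sub>v (transpose_mat M *\<^sub>v x')"
    using assms by (auto simp: graph_space_def)
  then show "transpose_mat M *\<^sub>v x = y"
    using assms append_vec_eq[of x l x'] by simp
next
  assume "transpose_mat M *\<^sub>v x = y"
  then show "x @\<^sub>v y \<in> graph_space M"
    using assms by (auto simp: graph_space_def)
qed

lemma graph_space_cases:
  assumes "M \<in> carrier_mat l m" "v \<in> graph_space M"
  obtains x where "x \<in> carrier_vec l" "v = x @\<^sub>v (transpose_mat M *\<^sub>v x)"
  using assms by (auto simp: graph_space_def)

lemma transpose_mult_carrier:
  "M \<in> carrier_mat l m \<Longrightarrow> x \<in> carrier_vec l \<Longrightarrow> transpose_mat M *\<^sub>v x \<in> carrier_vec m"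
  by (intro mult_mat_vec_carrier[of _ _ l]) auto

lemma bit_subspace_graph_space:
  assumes M: "M \<in> carrier_mat l m"
  shows "bit_subspace (l + m) (graph_space M)" "card (graph_space M) = 2 ^ l"
proof -
  let ?g = "\<lambda>x. x @\<^sub>v (transpose_mat M *\<^sub>v x)"
  have eq: "graph_space M = ?g ` carrier_vec l"
    using M by (simp add: graph_space_def)
  have "?g x + ?g y = ?g (x + y)" if "x \<in> carrier_vec l" "y \<in> carrier_vec l" for x y
  proof -
    have "?g x + ?g y = (x + y) @\<^sub>v (transpose_mat M *\<^sub>v x + transpose_mat M *\<^sub>v y)"
      using that transpose_mult_carrier[OF M] by (intro append_vec_add)
    also have "transpose_mat M *\<^sub>v x + transpose_mat M *\<^sub>v y = transpose_mat M *\<^sub>v (x + y)"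
      using that M by (intro mult_add_distrib_mat_vec[symmetric]) auto
    finally show ?thesis .
  qed
  then have "additive_on (carrier_vec l) ?g"
    by (simp add: additive_on_def)
  then show "bit_subspace (l + m) (graph_space M)"
    unfolding eq using transpose_mult_carrier[OF M] by (intro bit_subspace_image[OF _ bit_subspace_carrier]) auto
  have "inj_on ?g (carrier_vec l)"
    by (intro inj_onI) simp
  then show "card (graph_space M) = 2 ^ l"
    by (simp add: eq card_image card_carrier_vec_bit)
qed

lemma graph_space_vert: "M \<in> carrier_mat l m \<Longrightarrow> graph_space M \<in> grassmann_verts l (l + m)"
  by (simp add: mem_grassmann_verts bit_subspace_graph_space)

lemma graph_space_inj: "inj_on graph_space (carrier_mat l m)"
proof (rule inj_onI)
  fix M M' :: "bit Matrix.mat"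
  assume M: "M \<in> carrier_mat l m" and M': "M' \<in> carrier_mat l m" and eq: "graph_space M = graph_space M'"
  have "M $$ (i, j) = M' $$ (i, j)" if "i < l" "j < m" for i j
  proof -
    have "unit_vec l i @\<^sub>v (transpose_mat M *\<^sub>v unit_vec l i) \<in> graph_space M'"
      using append_in_graph_space[OF M, of "unit_vec l i"] eq by simp
    then have "transpose_mat M' *\<^sub>v unit_vec l i = transpose_mat M *\<^sub>v unit_vec l i"
      using append_in_graph_space[OF M', of "unit_vec l i"] by simp
    then have "vec_index (transpose_mat M' *\<^sub>v unit_vec l i) j = vec_index (transpose_mat M *\<^sub>v unit_vec l i) j"
      by simp
    then show ?thesis
      using that M M' by simp
  qed
  then show "M = M'"
    using M M' by (intro eq_matI) auto
qed

lemma bit_subspace_vertical: "bit_subspace (l + m) (vertical l m)" "card (vertical l m) = 2 ^ m"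
proof -
  have "additive_on (carrier_vec m) (\<lambda>y. 0\<^sub>v l @\<^sub>v y)"
    using append_vec_add[of "0\<^sub>v l" l "0\<^sub>v l"] by (auto simp: additive_on_def)
  then show "bit_subspace (l + m) (vertical l m)"
    unfolding vertical_def by (intro bit_subspace_image[OF _ bit_subspace_carrier]) auto
  have "inj_on (\<lambda>y. 0\<^sub>v l @\<^sub>v y) (carrier_vec m :: bvec set)"
    by (intro inj_onI) (simp add: append_vec_eq[of _ l])
  then show "card (vertical l m) = 2 ^ m"
    unfolding vertical_def by (simp only: card_image card_carrier_vec_bit)
qed

lemma zero_append_zero: "0\<^sub>v l @\<^sub>v 0\<^sub>v m = 0\<^sub>v (l + m)"
  by (intro eq_vecI) auto

lemma graph_space_Int_vertical:
  assumes M: "M \<in> carrier_mat l m"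
  shows "graph_space M \<inter> vertical l m = {0\<^sub>v (l + m)}"
proof -
  have "v = 0\<^sub>v (l + m)" if v: "v \<in> graph_space M" "v \<in> vertical l m" for v
  proof -
    obtain x where x: "x \<in> carrier_vec l" "v = x @\<^sub>v (transpose_mat M *\<^sub>v x)"
      using graph_space_cases[OF M v(1)] .
    obtain y where y: "v = 0\<^sub>v l @\<^sub>v y"
      using v(2) by (auto simp: vertical_def)
    have "x = 0\<^sub>v l"
      using x y append_vec_eq[of "0\<^sub>v l" l x] by simp
    moreover have "transpose_mat M *\<^sub>v 0\<^sub>v l = 0\<^sub>v m"
      using M by (intro eq_vecI) auto
    ultimately show ?thesis
      using x by (simp add: zero_append_zero)
  qed
  then show ?thesis
    using bit_subspaceD(2)[OF bit_subspace_graph_space(1)[OF M]] bit_subspaceD(2)[OF bit_subspace_vertical(1)[of l m]] by blast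
qed

text \<open>The kernel of the projection of \<open>V\<close> to the first \<open>l\<close>
  coordinates lies in the vertical space and is therefore zero. By cardinality the projection is
  bijective.\<close>

lemma complement_is_graph:
  assumes V: "bit_subspace (l + m) V" "card V = 2 ^ l" and VU: "V \<inter> vertical l m = {0\<^sub>v (l + m)}"
  obtains M where "M \<in> carrier_mat l m" "V = graph_space M"
proof -
  have Vc: "v \<in> carrier_vec (l + m)" if "v \<in> V" for v
    using bit_subspaceD(1)[OF V(1) that] .
  have split: "v = vec_first v l @\<^sub>v vec_last v m" if "v \<in> V" for v
    using Vc[OF that] by simp
  have fadd: "vec_first (v + w) l = vec_first v l + vec_first w l"
    "vec_last (v + w) m = vec_last v m + vec_last w m" if "v \<in> V" "w \<in> V" for v w
    using Vc[OF that(1)] Vc[OF that(2)] by (auto simp: vec_first_def vec_last_def)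
  have inj: "inj_on (\<lambda>v. vec_first v l) V"
  proof (rule inj_onI)
    fix v w assume vw: "v \<in> V" "w \<in> V" "vec_first v l = vec_first w l"
    have "vec_first (v + w) l = 0\<^sub>v l"
      using fadd(1)[OF vw(1,2)] vw(3) by (simp add: vec_add_self)
    then have "v + w = 0\<^sub>v l @\<^sub>v vec_last (v + w) m"
      using split[OF bit_subspaceD(3)[OF V(1) vw(1,2)]] by simp
    then have "v + w \<in> vertical l m"
      unfolding vertical_def using vec_last_carrier by blast
    then have "v + w = 0\<^sub>v (l + m)"
      using VU bit_subspaceD(3)[OF V(1) vw(1,2)] by blast
    then show "v = w"
      using vec_add_eq_zero_iff[OF Vc Vc] vw by blast
  qed
  have img: "(\<lambda>v. vec_first v l) ` V = carrier_vec l"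
    using inj V(2) by (intro card_subset_eq) (auto simp: card_image card_carrier_vec_bit)
  \<comment> \<open>The inverse of the projection; its last \<open>m\<close> coordinates are the
    additive map whose graph is \<open>V\<close>.\<close>
  define r where "r = inv_into V (\<lambda>v. vec_first v l)"
  have r: "r x \<in> V" "vec_first (r x) l = x" if "x \<in> carrier_vec l" for x
    using that img unfolding r_def by (auto intro: inv_into_into f_inv_into_f)
  have radd: "r (x + y) = r x + r y" if "x \<in> carrier_vec l" "y \<in> carrier_vec l" for x y
  proof (rule inj_onD[OF inj])
    show "vec_first (r (x + y)) l = vec_first (r x + r y) l"
      using that r fadd(1)[OF r(1) r(1)] by simp
  qed (use that r bit_subspaceD(3)[OF V(1)] in auto)
  have "additive_on (carrier_vec l) (\<lambda>x. vec_last (r x) m)"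
    using radd r fadd(2) by (auto simp: additive_on_def)
  then obtain M where M: "M \<in> carrier_mat l m"
    "\<And>x. x \<in> carrier_vec l \<Longrightarrow> vec_last (r x) m = transpose_mat M *\<^sub>v x"
    by (rule additive_mat[where m = m]) auto
  have "graph_space M \<subseteq> V"
  proof
    fix v assume "v \<in> graph_space M"
    then obtain x where x: "x \<in> carrier_vec l" "v = x @\<^sub>v (transpose_mat M *\<^sub>v x)"
      using graph_space_cases[OF M(1)] by blast
    then have "v = r x"
      using split[OF r(1)] r(2) M(2) by metis
    then show "v \<in> V"
      using r x by simp
  qed
  then have "graph_space M = V"
    using V bit_subspace_graph_space(2)[OF M(1)] by (intro card_subset_eq bit_subspace_finite) auto
  then show ?thesis
    using that M(1) by blast
qed

section \<open>Shortcode steps as edges of the Grassmann graph\<close>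

lemma outer_prod_carrier: "a \<in> carrier_vec l \<Longrightarrow> b \<in> carrier_vec m \<Longrightarrow> outer_prod a b \<in> carrier_mat l m"
  by (auto simp: outer_prod_def)

lemma outer_prod_transpose_mult:
  assumes "a \<in> carrier_vec l" "b \<in> carrier_vec m" "x \<in> carrier_vec l"
  shows "transpose_mat (outer_prod a b) *\<^sub>v x = scalar_prod a x \<cdot>\<^sub>v b"
  using assms
  by (intro eq_vecI) (auto simp: outer_prod_def scalar_prod_def sum_distrib_right sum_distrib_left ac_simps)

lemma nonzero_vec_index:
  fixes a :: bvec
  assumes "a \<in> carrier_vec l" "a \<noteq> 0\<^sub>v l"
  obtains i where "i < l" "vec_index a i = 1"
proof -
  have "\<exists>i<l. vec_index a i \<noteq> 0"
  proof (rule ccontr)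
    assume "\<not> ?thesis"
    then have "a = 0\<^sub>v l"
      using assms by (intro eq_vecI) auto
    then show False
      using assms by simp
  qed
  then show ?thesis
    using that by auto
qed

text \<open>The two matrices agree, in transposed action, on the vectors orthogonal to
  \<open>a\<close>: elsewhere the values differ by \<open>b\<close>, which is nonzero. As
  \<open>a\<close> is nonzero, these vectors form a hyperplane.\<close>

lemma bit_adj_graph_space:
  assumes M: "M \<in> carrier_mat l m" and a: "a \<in> carrier_vec l" "a \<noteq> 0\<^sub>v l"
    and b: "b \<in> carrier_vec m" "b \<noteq> 0\<^sub>v m"
  shows "bit_adj (l + m) (graph_space M) (graph_space (M + outer_prod a b))"
proof -
  let ?M' = "M + outer_prod a b"
  have M': "?M' \<in> carrier_mat l m"
    using M outer_prod_carrier[OF a(1) b(1)] by simp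
  have mult: "transpose_mat ?M' *\<^sub>v x = transpose_mat M *\<^sub>v x + scalar_prod a x \<cdot>\<^sub>v b"
    if x: "x \<in> carrier_vec l" for x
  proof -
    have "transpose_mat ?M' *\<^sub>v x = (transpose_mat M + transpose_mat (outer_prod a b)) *\<^sub>v x"
      using transpose_add[OF M outer_prod_carrier[OF a(1) b(1)]] by simp
    also have "\<dots> = transpose_mat M *\<^sub>v x + transpose_mat (outer_prod a b) *\<^sub>v x"
      using M x outer_prod_carrier[OF a(1) b(1)] by (intro add_mult_distrib_mat_vec) auto
    finally show ?thesis
      using outer_prod_transpose_mult[OF a(1) b(1) x] by simp
  qed
  have agree: "transpose_mat ?M' *\<^sub>v x = transpose_mat M *\<^sub>v x \<longleftrightarrow> scalar_prod a x = 0"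
    if x: "x \<in> carrier_vec l" for x
  proof (cases "scalar_prod a x")
    case zero
    have "(0::bit) \<cdot>\<^sub>v b = 0\<^sub>v m"
      using b by auto
    then show ?thesis
      using zero mult[OF x] transpose_mult_carrier[OF M x] by simp
  next
    case one
    have "transpose_mat M *\<^sub>v x + b \<noteq> transpose_mat M *\<^sub>v x"
    proof
      assume *: "transpose_mat M *\<^sub>v x + b = transpose_mat M *\<^sub>v x"
      have "b = 0\<^sub>v m"
        using vec_add_self_left[OF transpose_mult_carrier[OF M x] b(1)]
          vec_add_self[OF transpose_mult_carrier[OF M x]] * by simp
      then show False
        using b by simp
    qed
    then show ?thesis
      using one mult[OF x] by simp
  qed
  let ?K = "{x \<in> carrier_vec l. scalar_prod a x = 0}"
  have "graph_space M \<inter> graph_space ?M' = (\<lambda>x. x @\<^sub>v (transpose_mat M *\<^sub>v x)) ` ?K"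
  proof (intro subset_antisym subsetI)
    fix v assume v: "v \<in> graph_space M \<inter> graph_space ?M'"
    then obtain x where x: "x \<in> carrier_vec l" "v = x @\<^sub>v (transpose_mat M *\<^sub>v x)"
      using graph_space_cases[OF M] by blast
    then have "transpose_mat ?M' *\<^sub>v x = transpose_mat M *\<^sub>v x"
      using v append_in_graph_space[OF M' x(1)] by simp
    then show "v \<in> (\<lambda>x. x @\<^sub>v (transpose_mat M *\<^sub>v x)) ` ?K"
      using agree x by blast
  next
    fix v assume "v \<in> (\<lambda>x. x @\<^sub>v (transpose_mat M *\<^sub>v x)) ` ?K"
    then obtain x where x: "x \<in> carrier_vec l" "scalar_prod a x = 0" "v = x @\<^sub>v (transpose_mat M *\<^sub>v x)"
      by blast
    then show "v \<in> graph_space M \<inter> graph_space ?M'"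
      using append_in_graph_space[OF M x(1)] append_in_graph_space[OF M' x(1)] agree[OF x(1)] by simp
  qed
  moreover have "inj_on (\<lambda>x. x @\<^sub>v (transpose_mat M *\<^sub>v x)) ?K"
    by (intro inj_onI) (simp add: append_vec_eq[of _ l])
  ultimately have "card (graph_space M \<inter> graph_space ?M') = card ?K"
    by (simp add: card_image)
  moreover have "2 ^ l = 2 * card ?K"
  proof -
    obtain i where i: "i < l" "vec_index a i = 1"
      using nonzero_vec_index[OF a] .
    have "card (carrier_vec l :: bvec set) = 2 * card ?K"
      by (rule kernel_index_two(2)[OF bit_subspace_carrier, where v = "unit_vec l i"])
        (use i a in \<open>auto simp: scalar_prod_add_distrib[of _ l]\<close>)
    then show ?thesis
      by (simp add: card_carrier_vec_bit)
  qed
  ultimately show ?thesis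
    using bit_subspace_graph_space[OF M] bit_subspace_graph_space[OF M'] by (simp add: bit_adj_def)
qed

text \<open>A nonzero rank-one matrix determines its factors up to a scalar, and over two elements
  the only nonzero scalar is 1.\<close>

lemma outer_prod_inj:
  assumes a: "a \<in> carrier_vec l" "a \<noteq> 0\<^sub>v l" and b: "b \<in> carrier_vec m" "b \<noteq> 0\<^sub>v m"
    and c: "c \<in> carrier_vec l" "c \<noteq> 0\<^sub>v l" and d: "d \<in> carrier_vec m" "d \<noteq> 0\<^sub>v m"
    and eq: "outer_prod a b = outer_prod c d"
  shows "a = c \<and> b = d"
proof -
  have *: "vec_index a i * vec_index b j = vec_index c i * vec_index d j" if "i < l" "j < m" for i j
    using arg_cong[OF eq, of "\<lambda>M. M $$ (i, j)"] that a b c d by (simp add: outer_prod_def)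
  obtain i where i: "i < l" "vec_index a i = 1"
    using nonzero_vec_index[OF a] .
  obtain j where j: "j < m" "vec_index b j = 1"
    using nonzero_vec_index[OF b] .
  \<comment> \<open>A product equal to 1 has both factors 1. Column \<open>j\<close> then shows
    \<open>a = c\<close>, and row \<open>i\<close> shows \<open>b = d\<close>.\<close>
  have ij: "vec_index c i = 1" "vec_index d j = 1"
    using *[OF i(1) j(1)] i j by (cases "vec_index c i"; cases "vec_index d j"; simp)+
  have "a = c"
    using *[OF _ j(1)] j ij a c by (intro eq_vecI) auto
  moreover have "b = d"
    using *[OF i(1)] i ij b d by (intro eq_vecI) auto
  ultimately show ?thesis ..
qed

section \<open>Nice sets and zooms\<close>

fun bit_span :: "nat \<Rightarrow> (nat \<Rightarrow> bvec) \<Rightarrow> nat \<Rightarrow> bvec set" where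
  "bit_span n p 0 = {0\<^sub>v n}"
| "bit_span n p (Suc k) = adjoin n (p k) (bit_span n p k)"

text \<open>The vectors \<open>p i\<close> may be dependent, hence only an upper bound on the
  cardinality.\<close>

lemma bit_span:
  assumes "\<And>i. i < k \<Longrightarrow> p i \<in> carrier_vec n"
  shows "bit_subspace n (bit_span n p k)" "card (bit_span n p k) \<le> 2 ^ k"
    "bit_subspace n V \<Longrightarrow> bit_span n p k \<subseteq> V \<longleftrightarrow> (\<forall>i<k. p i \<in> V)"
proof -
  have "bit_subspace n (bit_span n p k) \<and> card (bit_span n p k) \<le> 2 ^ k \<and>
    (\<forall>V. bit_subspace n V \<longrightarrow> (bit_span n p k \<subseteq> V \<longleftrightarrow> (\<forall>i<k. p i \<in> V)))"
    using assms
  proof (induction k)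
    case 0
    then show ?case
      by (auto simp: bit_subspace_zero bit_subspaceD(2))
  next
    case (Suc k)
    then have IH: "bit_subspace n (bit_span n p k)" "card (bit_span n p k) \<le> 2 ^ k"
      "\<And>V. bit_subspace n V \<Longrightarrow> bit_span n p k \<subseteq> V \<longleftrightarrow> (\<forall>i<k. p i \<in> V)" and p: "p k \<in> carrier_vec n"
      by auto
    have "card (adjoin n (p k) (bit_span n p k)) \<le> card (bit_span n p k) + card ((\<lambda>x. x + p k) ` bit_span n p k)"
      unfolding adjoin_eq[OF IH(1)] by (rule card_Un_le)
    also have "card ((\<lambda>x. x + p k) ` bit_span n p k) \<le> card (bit_span n p k)"
      by (rule card_image_le[OF bit_subspace_finite[OF IH(1)]])
    finally have "card (adjoin n (p k) (bit_span n p k)) \<le> 2 ^ Suc k"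
      using IH(2) by simp
    then show ?case
      using bit_subspace_adjoin[OF IH(1) p] adjoin_subset_iff[OF IH(1) p] IH(3) by (auto simp: less_Suc_eq)
  qed
  then show "bit_subspace n (bit_span n p k)" "card (bit_span n p k) \<le> 2 ^ k"
    "bit_subspace n V \<Longrightarrow> bit_span n p k \<subseteq> V \<longleftrightarrow> (\<forall>i<k. p i \<in> V)"
    by blast+
qed

text \<open>Generators of \<open>Q\<close> relative to \<open>A\<close>. The relative form lets the
  induction replace \<open>A\<close> by \<open>A\<close> with one vector of \<open>Q\<close>
  adjoined.\<close>

lemma bit_span_exists:
  assumes "bit_subspace n A" "bit_subspace n Q" "A \<subseteq> Q" "card Q = 2 ^ k * card A"
  shows "\<exists>p. (\<forall>i<k. p i \<in> carrier_vec n) \<and>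
    (\<forall>V. bit_subspace n V \<longrightarrow> A \<subseteq> V \<longrightarrow> (Q \<subseteq> V \<longleftrightarrow> (\<forall>i<k. p i \<in> V)))"
  using assms
proof (induction k arbitrary: A)
  case 0
  then have "A = Q"
    using bit_subspace_finite card_subset_eq by (metis mult_1 power_0)
  then show ?case
    by auto
next
  case (Suc k)
  have "card A \<noteq> card Q"
    using Suc.prems bit_subspace_card_pos[of n A] by auto
  then have "A \<noteq> Q"
    by metis
  then obtain a where a: "a \<in> Q" "a \<notin> A"
    using Suc.prems(3) by blast
  have ac: "a \<in> carrier_vec n"
    using a Suc.prems bit_subspaceD(1) by blast
  have "card Q = 2 ^ k * card (adjoin n a A)"
    using Suc.prems card_adjoin[OF Suc.prems(1) ac a(2)] by simp
  moreover have "adjoin n a A \<subseteq> Q"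
    using Suc.prems a by (intro adjoin_least) auto
  ultimately obtain p where p: "\<forall>i<k. p i \<in> carrier_vec n"
    "\<And>V. bit_subspace n V \<Longrightarrow> adjoin n a A \<subseteq> V \<Longrightarrow> Q \<subseteq> V \<longleftrightarrow> (\<forall>i<k. p i \<in> V)"
    using Suc.IH[OF bit_subspace_adjoin[OF Suc.prems(1) ac] Suc.prems(2)] by blast
  have "Q \<subseteq> V \<longleftrightarrow> (\<forall>i<Suc k. (p(k := a)) i \<in> V)" if V: "bit_subspace n V" "A \<subseteq> V" for V
  proof (cases "a \<in> V")
    case True
    then have "adjoin n a A \<subseteq> V"
      using adjoin_least[OF V(1)] V(2) by blast
    then show ?thesis
      using p(2)[OF V(1)] True by (auto simp: less_Suc_eq)
  next
    case False
    then show ?thesis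
      using a by auto
  qed
  moreover have "\<forall>i<Suc k. (p(k := a)) i \<in> carrier_vec n"
    using p ac by (auto simp: less_Suc_eq)
  ultimately show ?case
    by blast
qed

lemma bit_subspace_generators:
  assumes Q: "bit_subspace n Q" "card Q = 2 ^ k"
  obtains p where "\<forall>i<k. p i \<in> carrier_vec n" "\<And>V. bit_subspace n V \<Longrightarrow> Q \<subseteq> V \<longleftrightarrow> (\<forall>i<k. p i \<in> V)"
proof -
  have "{0\<^sub>v n} \<subseteq> Q"
    using bit_subspaceD(2)[OF Q(1)] by simp
  then have "\<exists>p. (\<forall>i<k. p i \<in> carrier_vec n) \<and>
    (\<forall>V. bit_subspace n V \<longrightarrow> {0\<^sub>v n} \<subseteq> V \<longrightarrow> (Q \<subseteq> V \<longleftrightarrow> (\<forall>i<k. p i \<in> V)))"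
    using Q by (intro bit_span_exists bit_subspace_zero) auto
  then show ?thesis
    using that bit_subspaceD(2) by (metis empty_subsetI insert_subset)
qed

definition annihilator :: "nat \<Rightarrow> (nat \<Rightarrow> bvec) \<Rightarrow> nat \<Rightarrow> bvec set" where
  "annihilator n w k = {v \<in> carrier_vec n. \<forall>i<k. scalar_prod (w i) v = 0}"

text \<open>Each equation at most halves the space, also when it depends on the earlier
  ones.\<close>

lemma annihilator:
  assumes "\<And>i. i < k \<Longrightarrow> w i \<in> carrier_vec n"
  shows "bit_subspace n (annihilator n w k)" "2 ^ n \<le> 2 ^ k * card (annihilator n w k)"
proof -
  have "bit_subspace n (annihilator n w k) \<and> 2 ^ n \<le> 2 ^ k * card (annihilator n w k)"
    using assms
  proof (induction k)
    case 0
    then show ?case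
      by (simp add: annihilator_def bit_subspace_carrier card_carrier_vec_bit)
  next
    case (Suc k)
    then have IH: "bit_subspace n (annihilator n w k)" "2 ^ n \<le> 2 ^ k * card (annihilator n w k)"
      and w: "w k \<in> carrier_vec n"
      by auto
    have eq: "annihilator n w (Suc k) = {v \<in> annihilator n w k. scalar_prod (w k) v = 0}"
      by (auto simp: annihilator_def less_Suc_eq)
    have add: "scalar_prod (w k) (x + y) = scalar_prod (w k) x + scalar_prod (w k) y"
      if "x \<in> annihilator n w k" "y \<in> annihilator n w k" for x y
      using w bit_subspaceD(1)[OF IH(1)] that by (intro scalar_prod_add_distrib) auto
    have "card (annihilator n w k) \<le> 2 * card (annihilator n w (Suc k))"
      unfolding eq by (rule kernel_index_two(3)[OF IH(1) add])
    then have "2 ^ k * card (annihilator n w k) \<le> 2 ^ Suc k * card (annihilator n w (Suc k))"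
      by simp
    then show ?case
      using kernel_index_two(1)[OF IH(1) add] IH(2) unfolding eq by (meson order_trans)
  qed
  then show "bit_subspace n (annihilator n w k)" "2 ^ n \<le> 2 ^ k * card (annihilator n w k)"
    by blast+
qed

text \<open>The coordinate subspace \<open>S\<close> has obvious equations, namely that the last
  \<open>k\<close> coordinates vanish. An automorphism taking \<open>W\<close> to \<open>S\<close>
  pulls them back.\<close>

lemma bit_subspace_equations:
  assumes W: "bit_subspace n W" "card W = 2 ^ d" "d + k = n"
  obtains w where "\<forall>i<k. w i \<in> carrier_vec n" "W = annihilator n w k"
proof -
  define S :: "bvec set" where "S = (\<lambda>x. x @\<^sub>v 0\<^sub>v k) ` carrier_vec d"
  have "inj_on (\<lambda>x. x @\<^sub>v 0\<^sub>v k) (carrier_vec d :: bvec set)"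
    by (intro inj_onI) (simp add: append_vec_eq[of _ d])
  then have "card S = 2 ^ d"
    by (simp add: S_def card_image card_carrier_vec_bit)
  moreover have "additive_on (carrier_vec d) (\<lambda>x. x @\<^sub>v 0\<^sub>v k)"
    using append_vec_add[of _ d _ "0\<^sub>v k" k "0\<^sub>v k"] by (auto simp: additive_on_def)
  then have "bit_subspace n S"
    unfolding S_def using W(3) by (intro bit_subspace_image[OF _ bit_subspace_carrier]) auto
  ultimately obtain g where g: "g \<in> Aut n" "g ` W = S"
    using Aut_transitive[OF W(1)] W(2) by metis
  have S_iff: "v \<in> S \<longleftrightarrow> (\<forall>i<k. vec_index v (d + i) = 0)" if v: "v \<in> carrier_vec n" for v
  proof
    assume *: "\<forall>i<k. vec_index v (d + i) = 0"
    have "v = vec_first v d @\<^sub>v 0\<^sub>v k"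
    proof (intro eq_vecI)
      fix i assume "i < dim_vec (vec_first v d @\<^sub>v (0\<^sub>v k :: bvec))"
      then show "vec_index v i = vec_index (vec_first v d @\<^sub>v 0\<^sub>v k) i"
        using *[rule_format, of "i - d"] v W(3) by (auto simp: vec_first_def)
    qed (use v W(3) in auto)
    then show "v \<in> S"
      by (auto simp: S_def)
  qed (auto simp: S_def)
  have "additive_on (carrier_vec n) g" "g ` carrier_vec n \<subseteq> carrier_vec n"
    using g(1) AutD(2)[OF g(1)] by (auto simp: Aut_def)
  then obtain M where M: "M \<in> carrier_mat n n" "\<And>x. x \<in> carrier_vec n \<Longrightarrow> g x = transpose_mat M *\<^sub>v x"
    by (rule additive_mat) auto
  have "v \<in> W \<longleftrightarrow> v \<in> annihilator n (\<lambda>i. col M (d + i)) k" if v: "v \<in> carrier_vec n" for v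
  proof -
    have "v \<in> W \<longleftrightarrow> g v \<in> S"
      using inj_image_mem_iff[OF AutD(4)[OF g(1)], of v W] g(2) by simp
    also have "\<dots> \<longleftrightarrow> (\<forall>i<k. vec_index (g v) (d + i) = 0)"
      using S_iff[OF AutD(2)[OF g(1) v]] .
    \<comment> \<open>Coordinate \<open>d + i\<close> of \<open>g v\<close> is the product of column
      \<open>d + i\<close> of \<open>M\<close> with \<open>v\<close>.\<close>
    also have "\<dots> \<longleftrightarrow> v \<in> annihilator n (\<lambda>i. col M (d + i)) k"
      using v M W(3) by (simp add: annihilator_def)
    finally show ?thesis .
  qed
  then have "W = annihilator n (\<lambda>i. col M (d + i)) k"
    using bit_subspaceD(1)[OF W(1)] unfolding annihilator_def by blast
  then show ?thesis
    using that[of "\<lambda>i. col M (d + i)"] M(1) by auto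
qed

lemma left_constraint_iff:
  assumes "M \<in> carrier_mat l m" "v \<in> carrier_vec (l + m)"
  shows "transpose_mat M *\<^sub>v vec_first v l = vec_last v m \<longleftrightarrow> v \<in> graph_space M"
  using append_in_graph_space[OF assms(1), of "vec_first v l" "vec_last v m"] assms(2) by simp

text \<open>By adjointness the product of \<open>(t, q)\<close> with the graph vector of
  \<open>x\<close> equals that of \<open>x\<close> with \<open>t + M q\<close>. It vanishes for all
  \<open>x\<close> exactly if \<open>t + M q = 0\<close>, which in characteristic two means
  \<open>M q = t\<close>.\<close>

lemma right_constraint_iff:
  assumes M: "M \<in> carrier_mat l m" and q: "q \<in> carrier_vec m" and t: "t \<in> carrier_vec l"
  shows "M *\<^sub>v q = t \<longleftrightarrow> (\<forall>v\<in>graph_space M. scalar_prod (t @\<^sub>v q) v = 0)"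
proof -
  have Mq: "M *\<^sub>v q \<in> carrier_vec l"
    using M q by (rule mult_mat_vec_carrier)
  have *: "scalar_prod (t @\<^sub>v q) (x @\<^sub>v (transpose_mat M *\<^sub>v x)) = scalar_prod x (t + M *\<^sub>v q)"
    if x: "x \<in> carrier_vec l" for x
  proof -
    have "scalar_prod (t @\<^sub>v q) (x @\<^sub>v (transpose_mat M *\<^sub>v x)) =
        scalar_prod t x + scalar_prod q (transpose_mat M *\<^sub>v x)"
      using x t q transpose_mult_carrier[OF M x] by (intro scalar_prod_append)
    also have "scalar_prod q (transpose_mat M *\<^sub>v x) = scalar_prod x (M *\<^sub>v q)"
      using transpose_vec_mult_scalar[OF M q x] comm_scalar_prod[OF q transpose_mult_carrier[OF M x]] by simp
    also have "scalar_prod t x = scalar_prod x t"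
      by (rule comm_scalar_prod[OF t x])
    also have "scalar_prod x t + scalar_prod x (M *\<^sub>v q) = scalar_prod x (t + M *\<^sub>v q)"
      using scalar_prod_add_distrib[OF x t Mq] by simp
    finally show ?thesis .
  qed
  have "(\<forall>v\<in>graph_space M. scalar_prod (t @\<^sub>v q) v = 0) \<longleftrightarrow>
      (\<forall>x\<in>carrier_vec l. scalar_prod x (t + M *\<^sub>v q) = 0)"
    using M * by (auto simp: graph_space_def)
  also have "\<dots> \<longleftrightarrow> t + M *\<^sub>v q = 0\<^sub>v l"
  proof
    assume 0: "\<forall>x\<in>carrier_vec l. scalar_prod x (t + M *\<^sub>v q) = 0"
    have "vec_index (t + M *\<^sub>v q) i = 0" if "i < l" for i
      using 0[rule_format, of "unit_vec l i"] that scalar_prod_left_unit[of "t + M *\<^sub>v q" l i] t Mq by simp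
    then show "t + M *\<^sub>v q = 0\<^sub>v l"
      using M t by (intro eq_vecI) auto
  qed simp
  also have "\<dots> \<longleftrightarrow> M *\<^sub>v q = t"
    using vec_add_eq_zero_iff[OF t Mq] by auto
  finally show ?thesis ..
qed

definition zoom_mats :: "nat \<Rightarrow> nat \<Rightarrow> bvec set \<Rightarrow> bvec set \<Rightarrow> bit Matrix.mat set" where
  "zoom_mats l m Q W = {M \<in> carrier_mat l m. Q \<subseteq> graph_space M \<and> graph_space M \<subseteq> W}"

text \<open>Left constraints put vectors into the graph, so \<open>Q\<close> is their span; right
  constraints are the equations of \<open>W\<close>. As constraints may be dependent,
  \<open>q\<close> plus the codimension of \<open>W\<close> is at most \<open>r\<close>, which is
  expressed without subtraction.\<close>

lemma nice_imp_zoom_mats: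
  assumes "nice l m r T"
  obtains Q W q w where "bit_subspace (l + m) Q" "card Q = 2 ^ q" "bit_subspace (l + m) W" "card W = 2 ^ w"
    "q + (l + m) \<le> r + w" "T = zoom_mats l m Q W" "T \<noteq> {}"
proof -
  obtain r1 r2 A B where r: "r1 + r2 = r" and A: "right_affine l m r1 A" and B: "left_affine l m r2 B"
    and T: "T = A \<inter> B" "T \<noteq> {}"
    using assms unfolding nice_def by blast
  obtain q t where qt: "\<forall>i<r1. q i \<in> carrier_vec m \<and> t i \<in> carrier_vec l"
    "A = {M \<in> carrier_mat l m. \<forall>i<r1. M *\<^sub>v q i = t i}"
    using A by (auto simp: right_affine_def)
  obtain s u where su: "\<forall>j<r2. s j \<in> carrier_vec l \<and> u j \<in> carrier_vec m"
    "B = {M \<in> carrier_mat l m. \<forall>j<r2. transpose_mat M *\<^sub>v s j = u j}"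
    using B by (auto simp: left_affine_def)
  define Q where "Q = bit_span (l + m) (\<lambda>j. s j @\<^sub>v u j) r2"
  define W where "W = annihilator (l + m) (\<lambda>i. t i @\<^sub>v q i) r1"
  have Q: "bit_subspace (l + m) Q" "card Q \<le> 2 ^ r2"
    "\<And>V. bit_subspace (l + m) V \<Longrightarrow> Q \<subseteq> V \<longleftrightarrow> (\<forall>j<r2. s j @\<^sub>v u j \<in> V)"
    unfolding Q_def using su(1) by (intro bit_span; simp)+
  have W: "bit_subspace (l + m) W" "2 ^ (l + m) \<le> 2 ^ r1 * card W"
    unfolding W_def using qt(1) by (intro annihilator; simp)+
  have "M \<in> T \<longleftrightarrow> M \<in> zoom_mats l m Q W" for M
  proof (cases "M \<in> carrier_mat l m")
    case M: True
    have "M \<in> B \<longleftrightarrow> (\<forall>j<r2. s j @\<^sub>v u j \<in> graph_space M)"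
      using M su append_in_graph_space[OF M] by auto
    moreover have "M \<in> A \<longleftrightarrow> (\<forall>i<r1. \<forall>v\<in>graph_space M. scalar_prod (t i @\<^sub>v q i) v = 0)"
      using M qt right_constraint_iff[OF M] by auto
    moreover have "graph_space M \<subseteq> W \<longleftrightarrow> (\<forall>i<r1. \<forall>v\<in>graph_space M. scalar_prod (t i @\<^sub>v q i) v = 0)"
      using bit_subspaceD(1)[OF bit_subspace_graph_space(1)[OF M]] unfolding W_def annihilator_def by blast
    ultimately show ?thesis
      using Q(3)[OF bit_subspace_graph_space(1)[OF M]] M unfolding T zoom_mats_def by blast
  next
    case False
    then show ?thesis
      using su(2) by (simp add: T zoom_mats_def)
  qed
  then have "T = zoom_mats l m Q W"
    by blast
  moreover have "F2_dim (l + m) Q \<le> r2"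
    using Q(2) unfolding card_bit_subspace_dim[OF Q(1)] by simp
  moreover have "(2::nat) ^ (l + m) \<le> 2 ^ (r1 + F2_dim (l + m) W)"
    using W(2) unfolding card_bit_subspace_dim[OF W(1)] power_add .
  then have "l + m \<le> r1 + F2_dim (l + m) W"
    by (rule power_le_imp_le_exp[rotated]) simp
  ultimately show ?thesis
    using that[OF Q(1) card_bit_subspace_dim[OF Q(1)] W(1) card_bit_subspace_dim[OF W(1)]] T(2) r by linarith
qed

text \<open>Generators of \<open>Q\<close> become left constraints and equations of \<open>W\<close>
  become right constraints. A nice set carries exactly \<open>r\<close> of them, so the list is
  padded.\<close>

lemma zoom_mats_nice:
  assumes Q: "bit_subspace (l + m) Q" "card Q = 2 ^ r1" and W: "bit_subspace (l + m) W" "card W = 2 ^ d" "d + r2 = l + m"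
    and r: "r1 + r2 \<le> r" and ne: "zoom_mats l m Q W \<noteq> {}"
  shows "nice l m r (zoom_mats l m Q W)"
proof -
  obtain p where p: "\<forall>j<r1. p j \<in> carrier_vec (l + m)"
    "\<And>V. bit_subspace (l + m) V \<Longrightarrow> Q \<subseteq> V \<longleftrightarrow> (\<forall>j<r1. p j \<in> V)"
    using bit_subspace_generators[OF Q] by metis
  obtain w where w: "\<forall>i<r2. w i \<in> carrier_vec (l + m)" "W = annihilator (l + m) w r2"
    using bit_subspace_equations[OF W] .
  \<comment> \<open>From index \<open>r2\<close> on the constraint reads
    \<open>M 0 = 0\<close>.\<close>
  define q where "q i = (if i < r2 then vec_last (w i) m else 0\<^sub>v m)" for i
  define t where "t i = (if i < r2 then vec_first (w i) l else 0\<^sub>v l)" for i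
  define A where "A = {M \<in> carrier_mat l m. \<forall>i<r - r1. M *\<^sub>v q i = t i}"
  define B where "B = {M \<in> carrier_mat l m. \<forall>j<r1. transpose_mat M *\<^sub>v vec_first (p j) l = vec_last (p j) m}"
  have "M \<in> A \<inter> B \<longleftrightarrow> M \<in> zoom_mats l m Q W" for M
  proof (cases "M \<in> carrier_mat l m")
    case M: True
    have "M \<in> B \<longleftrightarrow> Q \<subseteq> graph_space M"
      using M p(1) left_constraint_iff[OF M] p(2)[OF bit_subspace_graph_space(1)[OF M]] by (auto simp: B_def)
    moreover have triv: "M *\<^sub>v q i = t i" if "\<not> i < r2" for i
      using M that by (auto simp: q_def t_def)
    have "r2 \<le> r - r1"
      using r by simp
    then have "(\<forall>i<r - r1. M *\<^sub>v q i = t i) \<longleftrightarrow> (\<forall>i<r2. M *\<^sub>v q i = t i)"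
      using triv order_less_le_trans by blast
    then have "M \<in> A \<longleftrightarrow> (\<forall>i<r2. M *\<^sub>v q i = t i)"
      using M by (simp add: A_def)
    moreover have "M *\<^sub>v q i = t i \<longleftrightarrow> (\<forall>v\<in>graph_space M. scalar_prod (w i) v = 0)" if "i < r2" for i
      using right_constraint_iff[OF M, of "q i" "t i"] that w(1) by (simp add: q_def t_def)
    moreover have "graph_space M \<subseteq> W \<longleftrightarrow> (\<forall>i<r2. \<forall>v\<in>graph_space M. scalar_prod (w i) v = 0)"
      using bit_subspaceD(1)[OF bit_subspace_graph_space(1)[OF M]] unfolding w(2) annihilator_def by blast
    ultimately show ?thesis
      using M unfolding zoom_mats_def by blast
  next
    case False
    then show ?thesis
      by (simp add: A_def zoom_mats_def)
  qed
  then have eq: "A \<inter> B = zoom_mats l m Q W"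
    by blast
  have "right_affine l m (r - r1) A"
    unfolding right_affine_def A_def by (intro exI[of _ q] exI[of _ t]) (auto simp: q_def t_def)
  moreover have "left_affine l m r1 B"
    unfolding left_affine_def B_def
    by (intro exI[of _ "\<lambda>j. vec_first (p j) l"] exI[of _ "\<lambda>j. vec_last (p j) m"]) auto
  ultimately show ?thesis
    using eq ne r unfolding nice_def by (metis le_add_diff_inverse2 add_leD1)
qed

lemma graph_space_zoom_mats:
  "graph_space ` zoom_mats l m Q W = {V \<in> zoom l (l + m) Q W. V \<inter> vertical l m = {0\<^sub>v (l + m)}}"
proof (intro subset_antisym subsetI)
  fix V assume "V \<in> graph_space ` zoom_mats l m Q W"
  then obtain M where M: "M \<in> carrier_mat l m" "Q \<subseteq> graph_space M" "graph_space M \<subseteq> W" "V = graph_space M"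
    by (auto simp: zoom_mats_def)
  then show "V \<in> {V \<in> zoom l (l + m) Q W. V \<inter> vertical l m = {0\<^sub>v (l + m)}}"
    using bit_subspace_graph_space[OF M(1)] graph_space_Int_vertical[OF M(1)] by (simp add: mem_zoom)
next
  fix V assume V: "V \<in> {V \<in> zoom l (l + m) Q W. V \<inter> vertical l m = {0\<^sub>v (l + m)}}"
  then obtain M where "M \<in> carrier_mat l m" "V = graph_space M"
    using complement_is_graph[of l m V] by (auto simp: mem_zoom)
  then show "V \<in> graph_space ` zoom_mats l m Q W"
    using V by (auto simp: zoom_mats_def mem_zoom)
qed

text \<open>The graph spaces in the zoom are the complements, within \<open>W\<close>, of the
  vertical part \<open>U\<close> of \<open>W\<close>. Their number is the bare power of two, which
  the full zoom exceeds by a factor of at most 4.\<close>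

lemma card_zoom_mats_ge:
  assumes Q: "bit_subspace (l + m) Q" "card Q = 2 ^ q" and W: "bit_subspace (l + m) W" "card W = 2 ^ w"
    and ne: "zoom_mats l m Q W \<noteq> {}"
  shows "real (card (zoom l (l + m) Q W)) \<le> 4 * real (card (zoom_mats l m Q W))"
proof -
  obtain M where M: "M \<in> carrier_mat l m" "Q \<subseteq> graph_space M" "graph_space M \<subseteq> W"
    using ne by (auto simp: zoom_mats_def)
  note G = bit_subspace_graph_space[OF M(1)]
  define U where "U = W \<inter> vertical l m"
  have U: "bit_subspace (l + m) U" "U \<subseteq> W"
    using W bit_subspace_vertical by (auto simp: U_def bit_subspace_Int)
  have GU: "graph_space M \<inter> U = {0\<^sub>v (l + m)}"
    using graph_space_Int_vertical[OF M(1)] bit_subspaceD(2)[OF W(1)] unfolding U_def by blast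
  have QU: "Q \<inter> U = {0\<^sub>v (l + m)}"
    using GU M(2) bit_subspaceD(2)[OF Q(1)] bit_subspaceD(2)[OF U(1)] by blast
  \<comment> \<open>This gives \<open>U\<close> the right dimension. A vector of \<open>W\<close>
    differs from the graph vector with the same first \<open>l\<close> coordinates by a vertical
    vector, which again lies in \<open>W\<close>.\<close>
  have "ssum (graph_space M) U = W"
  proof
    show "ssum (graph_space M) U \<subseteq> W"
      using ssum_least[OF W(1) M(3) U(2)] .
    show "W \<subseteq> ssum (graph_space M) U"
    proof
      fix v assume v: "v \<in> W"
      then have vc: "v \<in> carrier_vec (l + m)"
        using bit_subspaceD(1)[OF W(1)] by blast
      define x where "x = vec_first v l"
      define g where "g = x @\<^sub>v (transpose_mat M *\<^sub>v x)"
      have x: "x \<in> carrier_vec l" "v = x @\<^sub>v vec_last v m"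
        using vc by (auto simp: x_def)
      have g: "g \<in> graph_space M" "g \<in> carrier_vec (l + m)"
        using append_in_graph_space[OF M(1) x(1)] bit_subspaceD(1)[OF G(1)] by (auto simp: g_def)
      have "g + v = g + (x @\<^sub>v vec_last v m)"
        using arg_cong[OF x(2), of "\<lambda>u. g + u"] .
      also have "\<dots> = (x + x) @\<^sub>v (transpose_mat M *\<^sub>v x + vec_last v m)"
        unfolding g_def
        by (rule append_vec_add[OF x(1) x(1) transpose_mult_carrier[OF M(1) x(1)] vec_last_carrier])
      finally have "g + v \<in> vertical l m"
        using x transpose_mult_carrier[OF M(1) x(1)] by (auto simp: vertical_def vec_add_self)
      moreover have "g + v \<in> W"
        using g M(3) v bit_subspaceD(3)[OF W(1)] by blast
      ultimately have "g + v \<in> U"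
        by (simp add: U_def)
      then show "v \<in> ssum (graph_space M) U"
        using ssumI[OF g(1), of "g + v" U] vec_add_self_left[OF g(2) vc] by simp
    qed
  qed
  then have cW: "card W = 2 ^ l * card U"
    using card_ssum[OF G(1) U(1) GU] G(2) by simp
  have lw: "l \<le> w" and ql: "q \<le> l"
    using card_mono[OF bit_subspace_finite[OF W(1)] M(3)] card_mono[OF bit_subspace_finite[OF G(1)] M(2)] G(2) Q(2) W(2)
    by auto
  then have cU: "card U = 2 ^ (w - l)"
    using cW W(2) power_add[of "2::nat" l "w - l"] by simp
  have "{V \<in> zoom l (l + m) Q W. V \<inter> vertical l m = {0\<^sub>v (l + m)}} =
    {V \<in> zoom l (l + m) Q W. V \<inter> U = {0\<^sub>v (l + m)}}"
    unfolding U_def mem_zoom by blast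
  then have "card (zoom_mats l m Q W) = card {V \<in> zoom l (l + m) Q W. V \<inter> U = {0\<^sub>v (l + m)}}"
    using card_image[OF inj_on_subset[OF graph_space_inj[of l m]], of "zoom_mats l m Q W"]
    unfolding graph_space_zoom_mats by (simp add: zoom_mats_def)
  then have "real (card (zoom_mats l m Q W)) = 2 ^ ((w - l) * (l - q))"
    using card_zoom_complement[OF Q(1) W(1) U(1) Q(2) W(2) _ U(2) QU cU ql lw] M by auto
  moreover have "real (card (zoom l (l + m) Q W)) \<le> 4 * 2 ^ ((w - l) * (l - q))"
    using M by (intro card_zoom_le_4 Q W ql lw) auto
  ultimately show ?thesis
    by simp
qed

section \<open>From the Grassmann graph to the shortcode graph\<close>

lemma expansion_eq:
  assumes S: "finite S" "S \<noteq> {}" and N: "\<And>v. v \<in> S \<Longrightarrow> finite (N v) \<and> N v \<noteq> {}"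
  shows "1 - expansion N S = (\<Sum>v\<in>S. real (card (N v \<inter> S)) / real (card (N v))) / real (card S)"
proof -
  let ?p = "pmf_of_set S \<bind> (\<lambda>v. pmf_of_set (N v))"
  have "1 - expansion N S = measure_pmf.prob ?p S"
    using measure_pmf.prob_compl[of S ?p] by (simp add: expansion_def Compl_eq_Diff_UNIV[symmetric] Compl_eq)
  also have "\<dots> = measure_pmf.expectation ?p (indicator S)"
    by simp
  also have "\<dots> = (\<Sum>v\<in>S. measure_pmf.expectation (pmf_of_set (N v)) (indicator S) /\<^sub>R real (card S))"
    using S N by (intro pmf_expectation_bind_pmf_of_set) auto
  also have "\<dots> = (\<Sum>v\<in>S. (real (card (N v \<inter> S)) / real (card (N v))) / real (card S))"
    using N by (intro sum.cong refl) (simp add: measure_pmf_of_set divide_inverse mult_ac)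
  finally show ?thesis
    by (simp add: sum_divide_distrib)
qed

lemma pair_pmf_of_set:
  assumes "finite A" "A \<noteq> {}" "finite B" "B \<noteq> {}"
  shows "pair_pmf (pmf_of_set A) (pmf_of_set B) = pmf_of_set (A \<times> B)"
proof (rule pmf_eqI)
  show "pmf (pair_pmf (pmf_of_set A) (pmf_of_set B)) x = pmf (pmf_of_set (A \<times> B)) x" for x
    using assms by (cases x) (simp add: pmf_pair indicator_def card_cartesian_product)
qed

lemma finite_carrier_mat_bit: "finite (carrier_mat l m :: bit Matrix.mat set)"
proof -
  have "finite (graph_space ` (carrier_mat l m :: bit Matrix.mat set))"
    by (rule finite_subset[OF _ finite_grassmann_verts[of l "l + m"]]) (auto simp: graph_space_vert)
  then show ?thesis
    using graph_space_inj finite_imageD by blast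
qed

text \<open>Zero vectors are excluded because they produce loops, which the Grassmann graph does not
  have.\<close>

definition stay_triples :: "nat \<Rightarrow> nat \<Rightarrow> bit Matrix.mat set \<Rightarrow> (bit Matrix.mat \<times> bvec \<times> bvec) set" where
  "stay_triples l m S =
    {(M, a, b) \<in> S \<times> (carrier_vec l - {0\<^sub>v l}) \<times> (carrier_vec m - {0\<^sub>v m}). M + outer_prod a b \<in> S}"

lemma shortcode_stay_eq:
  assumes S: "S \<subseteq> carrier_mat l m" "S \<noteq> {}"
  shows "shortcode_stay l m S * (real (card S) * 2 ^ (l + m)) =
    real (card {(M, a, b) \<in> S \<times> carrier_vec l \<times> carrier_vec m. M + outer_prod a b \<in> S})"
proof -
  have finS: "finite S"
    using S finite_carrier_mat_bit finite_subset by blast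
  let ?P = "S \<times> (carrier_vec l :: bvec set) \<times> (carrier_vec m :: bvec set)"
  have ne: "(carrier_vec k :: bvec set) \<noteq> {}" for k
    using zero_carrier_vec by blast
  have "shortcode_stay l m S = measure_pmf.prob (pmf_of_set ?P) {(M, a, b). M + outer_prod a b \<in> S}"
    unfolding shortcode_stay_def using S finS ne by (simp add: pair_pmf_of_set)
  also have "\<dots> = real (card (?P \<inter> {(M, a, b). M + outer_prod a b \<in> S})) / real (card ?P)"
    using S finS ne by (intro measure_pmf_of_set) auto
  also have "?P \<inter> {(M, a, b). M + outer_prod a b \<in> S} = {(M, a, b) \<in> ?P. M + outer_prod a b \<in> S}"
    by auto
  also have "real (card ?P) = real (card S) * 2 ^ (l + m)"
    by (simp add: card_cartesian_product card_carrier_vec_bit power_add)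
  finally show ?thesis
    using S finS by (simp add: card_gt_0_iff)
qed

lemma shortcode_stay_le_1: "shortcode_stay l m S \<le> 1"
  by (simp add: shortcode_stay_def)

text \<open>The staying triples left out have \<open>a = 0\<close> or \<open>b = 0\<close>, which
  leaves at most \<open>2^l + 2^m\<close> pairs for each matrix.\<close>

lemma stay_triples_bounds:
  assumes S: "S \<subseteq> carrier_mat l m" "S \<noteq> {}"
  shows "real (card (stay_triples l m S)) \<le> shortcode_stay l m S * (real (card S) * 2 ^ (l + m))"
    and "shortcode_stay l m S * (real (card S) * 2 ^ (l + m)) \<le>
      real (card (stay_triples l m S)) + real (card S) * (2 ^ l + 2 ^ m)"
proof -
  have finS: "finite S"
    using S finite_carrier_mat_bit finite_subset by blast
  let ?A = "{(M, a, b) \<in> S \<times> carrier_vec l \<times> carrier_vec m. M + outer_prod a b \<in> S}"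
  let ?B = "S \<times> {0\<^sub>v l :: bvec} \<times> (carrier_vec m :: bvec set)"
    and ?C = "S \<times> (carrier_vec l :: bvec set) \<times> {0\<^sub>v m :: bvec}"
  have finA: "finite ?A"
    by (rule finite_subset[of _ "S \<times> carrier_vec l \<times> carrier_vec m"]) (use finS in auto)
  have sub: "stay_triples l m S \<subseteq> ?A"
    by (auto simp: stay_triples_def)
  then show "real (card (stay_triples l m S)) \<le> shortcode_stay l m S * (real (card S) * 2 ^ (l + m))"
    unfolding shortcode_stay_eq[OF S] using card_mono[OF finA sub] by simp
  have "card ?A \<le> card (stay_triples l m S \<union> (?B \<union> ?C))"
    using finite_subset[OF sub finA] finS by (intro card_mono) (auto simp: stay_triples_def)
  also have "\<dots> \<le> card (stay_triples l m S) + (card ?B + card ?C)"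
    using card_Un_le[of "stay_triples l m S" "?B \<union> ?C"] card_Un_le[of ?B ?C] by linarith
  also have "card ?B + card ?C = card S * (2 ^ l + 2 ^ m)"
    by (simp add: card_cartesian_product card_carrier_vec_bit algebra_simps)
  finally have "real (card ?A) \<le> real (card (stay_triples l m S) + card S * (2 ^ l + 2 ^ m))"
    by (rule of_nat_mono)
  then show "shortcode_stay l m S * (real (card S) * 2 ^ (l + m)) \<le>
      real (card (stay_triples l m S)) + real (card S) * (2 ^ l + 2 ^ m)"
    unfolding shortcode_stay_eq[OF S]
    by (simp only: of_nat_add of_nat_mult of_nat_power of_nat_numeral)
qed

section \<open>Degrees in the Grassmann graph and expansion of embedded sets\<close>

lemma mem_grassmann_nbrs:
  assumes "V \<in> grassmann_verts l n"
  shows "V' \<in> grassmann_nbrs l n V \<longleftrightarrow> bit_adj n V V'"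
proof -
  have V: "bit_subspace n V" "card V = 2 ^ l"
    using assms by (auto simp: mem_grassmann_verts)
  have "F2_dim n (V \<inter> V') + 1 = l \<longleftrightarrow> card V = 2 * card (V \<inter> V')" if V': "bit_subspace n V'"
  proof -
    have "card V = 2 * card (V \<inter> V') \<longleftrightarrow> (2::nat) ^ l = 2 ^ (F2_dim n (V \<inter> V') + 1)"
      using V card_bit_subspace_dim[OF bit_subspace_Int[OF V(1) V']] by simp
    also have "\<dots> \<longleftrightarrow> l = F2_dim n (V \<inter> V') + 1"
      by (rule power_inject_exp) simp
    finally show ?thesis
      by auto
  qed
  then show ?thesis
    using V by (auto simp: grassmann_nbrs_def mem_grassmann_verts bit_adj_def)
qed

lemma finite_grassmann_nbrs: "finite (grassmann_nbrs l n V)"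
  using finite_grassmann_verts by (auto simp: grassmann_nbrs_def)

text \<open>A neighbour of \<open>V\<close> arises from a hyperplane \<open>H\<close> of
  \<open>V\<close> and an \<open>l\<close>-dimensional space above \<open>H\<close>. There are at
  most \<open>4 * 2^(l-1)\<close> choices for the first and \<open>4 * 2^(n-l)\<close> for the
  second.\<close>

lemma card_grassmann_nbrs_le:
  assumes V: "V \<in> grassmann_verts l n" and l: "0 < l" "l \<le> n"
  shows "real (card (grassmann_nbrs l n V)) \<le> 8 * 2 ^ n"
proof -
  have Vs: "bit_subspace n V" "card V = 2 ^ l"
    using V by (auto simp: mem_grassmann_verts)
  let ?H = "zoom (l - 1) n {0\<^sub>v n} V"
  have Hle: "real (card ?H) \<le> 4 * 2 ^ (l - 1)"
    using card_zoom_le_4[OF bit_subspace_zero Vs(1), of 0 l "l - 1"] Vs l bit_subspaceD(2)[OF Vs(1)] by simp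
  have Zle: "real (card (zoom l n H (carrier_vec n))) \<le> 4 * 2 ^ (n - l)" if H: "H \<in> ?H" for H
  proof -
    have "bit_subspace n H" "card H = 2 ^ (l - 1)" "H \<subseteq> carrier_vec n"
      using H Vs(1) by (auto simp: mem_zoom bit_subspace_def)
    then show ?thesis
      using card_zoom_le_4[OF _ bit_subspace_carrier, where Q = H and q = "l - 1" and w = n and l = l] l by (simp add: card_carrier_vec_bit)
  qed
  have "grassmann_nbrs l n V \<subseteq> (\<Union>H\<in>?H. zoom l n H (carrier_vec n))"
  proof
    fix V' assume V': "V' \<in> grassmann_nbrs l n V"
    then have adj: "bit_adj n V V'"
      using mem_grassmann_nbrs[OF V] by simp
    then have V's: "bit_subspace n V'" "card V' = 2 ^ l"
      using Vs by (auto simp: bit_adj_def)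
    have "bit_subspace n (V \<inter> V')"
      using Vs V's by (intro bit_subspace_Int)
    moreover have "card (V \<inter> V') = 2 ^ (l - 1)"
      using adj Vs l by (cases l) (auto simp: bit_adj_def)
    ultimately have "V \<inter> V' \<in> ?H"
      using bit_subspaceD(2) by (auto simp: mem_zoom)
    moreover have "V' \<in> zoom l n (V \<inter> V') (carrier_vec n)"
      using V's by (auto simp: mem_zoom bit_subspace_def)
    ultimately show "V' \<in> (\<Union>H\<in>?H. zoom l n H (carrier_vec n))"
      by blast
  qed
  then have "card (grassmann_nbrs l n V) \<le> card (\<Union>H\<in>?H. zoom l n H (carrier_vec n))"
    by (intro card_mono) (auto simp: finite_zoom)
  also have "\<dots> \<le> (\<Sum>H\<in>?H. card (zoom l n H (carrier_vec n)))"
    by (rule card_UN_le[OF finite_zoom])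
  finally have "real (card (grassmann_nbrs l n V)) \<le> real (\<Sum>H\<in>?H. card (zoom l n H (carrier_vec n)))"
    by (rule of_nat_mono)
  also have "\<dots> = (\<Sum>H\<in>?H. real (card (zoom l n H (carrier_vec n))))"
    by (rule of_nat_sum)
  also have "\<dots> \<le> (\<Sum>H\<in>?H. 4 * 2 ^ (n - l))"
    by (intro sum_mono Zle)
  also have "\<dots> = real (card ?H) * (4 * 2 ^ (n - l))"
    by simp
  also have "\<dots> \<le> (4 * 2 ^ (l - 1)) * (4 * 2 ^ (n - l))"
    by (intro mult_right_mono Hle) simp
  also have "\<dots> = 8 * (2 ^ l * 2 ^ (n - l))"
    using l by (cases l) auto
  also have "\<dots> = 8 * 2 ^ n"
    using l by (simp flip: power_add)
  finally show ?thesis .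
qed

lemma graph_space_nbrs:
  assumes M: "M \<in> carrier_mat l m" and a: "a \<in> carrier_vec l - {0\<^sub>v l}" and b: "b \<in> carrier_vec m - {0\<^sub>v m}"
  shows "graph_space (M + outer_prod a b) \<in> grassmann_nbrs l (l + m) (graph_space M)"
  using bit_adj_graph_space[OF M, of a b] a b mem_grassmann_nbrs[OF graph_space_vert[OF M]] by simp

lemma nonzero_vec_exists: "0 < k \<Longrightarrow> unit_vec k 0 \<in> carrier_vec k - {0\<^sub>v k :: bvec}"
  by (simp add: unit_vec_nonzero)

lemma grassmann_nbrs_graph_nonempty:
  "M \<in> carrier_mat l m \<Longrightarrow> 0 < l \<Longrightarrow> 0 < m \<Longrightarrow> grassmann_nbrs l (l + m) (graph_space M) \<noteq> {}"
  using graph_space_nbrs nonzero_vec_exists by blast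

lemma mat_add_left_cancel_bit:
  fixes M A B :: "bit Matrix.mat"
  assumes "M \<in> carrier_mat l m" "A \<in> carrier_mat l m" "B \<in> carrier_mat l m" "M + A = M + B"
  shows "A = B"
proof (rule eq_matI)
  fix i j assume ij: "i < dim_row B" "j < dim_col B"
  have "M $$ (i, j) + A $$ (i, j) = M $$ (i, j) + B $$ (i, j)"
    using arg_cong[OF assms(4), of "\<lambda>X. X $$ (i, j)"] ij assms(1-3) by simp
  then show "A $$ (i, j) = B $$ (i, j)"
    by simp
qed (use assms in auto)

text \<open>Distinct nondegenerate steps from \<open>M\<close> lead to distinct neighbours, so the
  steps that stay in \<open>S\<close> are at most as many as the neighbours inside the image.
  Replacing the degree by its upper bound only lowers the fraction.\<close>

lemma expansion_graph_space:
  assumes S: "S \<subseteq> carrier_mat l m" "S \<noteq> {}" and pos: "0 < l" "0 < m"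
  shows "real (card (stay_triples l m S)) \<le>
    (1 - expansion (grassmann_nbrs l (l + m)) (graph_space ` S)) * (8 * (real (card S) * 2 ^ (l + m)))"
proof -
  let ?N = "grassmann_nbrs l (l + m)" and ?S = "graph_space ` S"
  have finS: "finite S"
    using S finite_carrier_mat_bit finite_subset by blast
  have inj: "inj_on graph_space S"
    using inj_on_subset[OF graph_space_inj S(1)] .
  let ?F = "\<lambda>M. {(a, b) \<in> (carrier_vec l - {0\<^sub>v l}) \<times> (carrier_vec m - {0\<^sub>v m}). M + outer_prod a b \<in> S}"
  have finF: "finite (?F M)" for M
    by (rule finite_subset[of _ "carrier_vec l \<times> carrier_vec m"]) auto
  have F: "card (?F M) \<le> card (?N (graph_space M) \<inter> ?S)" if M: "M \<in> S" for M
  proof (rule card_inj_on_le[where f = "\<lambda>(a, b). graph_space (M + outer_prod a b)"])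
    have Mc: "M \<in> carrier_mat l m"
      using M S by blast
    show "inj_on (\<lambda>(a, b). graph_space (M + outer_prod a b)) (?F M)"
    proof (rule inj_onI, clarsimp)
      fix a b c d :: bvec
      assume *: "a \<in> carrier_vec l" "a \<noteq> 0\<^sub>v l" "b \<in> carrier_vec m" "b \<noteq> 0\<^sub>v m" "M + outer_prod a b \<in> S"
        "c \<in> carrier_vec l" "c \<noteq> 0\<^sub>v l" "d \<in> carrier_vec m" "d \<noteq> 0\<^sub>v m" "M + outer_prod c d \<in> S"
        "graph_space (M + outer_prod a b) = graph_space (M + outer_prod c d)"
      then have "M + outer_prod a b = M + outer_prod c d"
        using inj by (auto dest: inj_onD)
      then have "outer_prod a b = outer_prod c d"
        using mat_add_left_cancel_bit[OF Mc] outer_prod_carrier * by blast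
      then show "a = c \<and> b = d"
        using outer_prod_inj * by blast
    qed
    show "(\<lambda>(a, b). graph_space (M + outer_prod a b)) ` ?F M \<subseteq> ?N (graph_space M) \<inter> ?S"
      using graph_space_nbrs[OF Mc] by auto
  qed (simp add: finite_grassmann_nbrs)
  have Dpos: "card (?N (graph_space M)) > 0" if "M \<in> S" for M
    using grassmann_nbrs_graph_nonempty[of M l m] that S pos finite_grassmann_nbrs
    by (auto simp: card_gt_0_iff)
  have quot: "real (card (?F M)) / (8 * 2 ^ (l + m)) \<le>
      real (card (?N (graph_space M) \<inter> ?S)) / real (card (?N (graph_space M)))" if M: "M \<in> S" for M
  proof (rule frac_le)
    show "real (card (?N (graph_space M))) \<le> 8 * 2 ^ (l + m)"
      using M S pos by (intro card_grassmann_nbrs_le graph_space_vert) auto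
  qed (use F[OF M] Dpos[OF M] in auto)
  have "stay_triples l m S = (SIGMA M:S. ?F M)"
    by (auto simp: stay_triples_def)
  then have "real (card (stay_triples l m S)) = (\<Sum>M\<in>S. real (card (?F M)))"
    using finS finF by (simp add: card_SigmaI)
  then have "real (card (stay_triples l m S)) / (8 * 2 ^ (l + m)) = (\<Sum>M\<in>S. real (card (?F M)) / (8 * 2 ^ (l + m)))"
    by (simp add: sum_divide_distrib)
  also have "\<dots> \<le> (\<Sum>M\<in>S. real (card (?N (graph_space M) \<inter> ?S)) / real (card (?N (graph_space M))))"
    by (intro sum_mono quot)
  also have "\<dots> = (\<Sum>V\<in>?S. real (card (?N V \<inter> ?S)) / real (card (?N V)))"
    by (simp add: sum.reindex[OF inj])
  also have "\<dots> = (1 - expansion ?N ?S) * real (card ?S)"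
    using S finS pos Dpos by (subst expansion_eq) (auto simp: finite_grassmann_nbrs card_gt_0_iff)
  also have "card ?S = card S"
    by (rule card_image[OF inj])
  finally show ?thesis
    by (simp add: field_simps)
qed

text \<open>The graph of \<open>M\<close> has dimension \<open>l\<close> and codimension
  \<open>m\<close>. Taken as \<open>Q\<close> or as \<open>W\<close>, it singles out
  \<open>M\<close>.\<close>

lemma singleton_nice:
  assumes M: "M \<in> carrier_mat l m" and r: "l \<le> r \<or> m \<le> r"
  shows "nice l m r {M}"
proof -
  note G = bit_subspace_graph_space[OF M]
  have inj: "M' = M" if "M' \<in> carrier_mat l m" "graph_space M' = graph_space M" for M'
    using inj_onD[OF graph_space_inj that(2)] that(1) M by blast
  have same: "graph_space M' = graph_space M"
    if "M' \<in> carrier_mat l m" "graph_space M \<subseteq> graph_space M' \<or> graph_space M' \<subseteq> graph_space M" for M'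
    using that bit_subspace_graph_space[OF that(1)] G card_subset_eq bit_subspace_finite by metis
  show ?thesis
    using r
  proof
    assume "l \<le> r"
    moreover have "zoom_mats l m (graph_space M) (carrier_vec (l + m)) = {M}"
      using inj same M G(1) by (auto simp: zoom_mats_def bit_subspace_def)
    ultimately show ?thesis
      using zoom_mats_nice[OF G bit_subspace_carrier, of "l + m" 0 r] by (simp add: card_carrier_vec_bit)
  next
    assume "m \<le> r"
    moreover have "zoom_mats l m {0\<^sub>v (l + m)} (graph_space M) = {M}"
      using inj same M bit_subspaceD(2)[OF G(1)] by (auto simp: zoom_mats_def)
    ultimately show ?thesis
      using zoom_mats_nice[OF bit_subspace_zero _ G, of 0 m r] by simp
  qed
qed

lemma GEH_imp_ISH:
  assumes "GEH"
  shows "ISH"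
  unfolding ISH_def
proof (intro allI impI)
  fix \<eta> :: real assume \<eta>: "0 < \<eta>"
  show "\<exists>\<delta> r. 0 < \<delta> \<and> (\<forall>l n S. S \<subseteq> carrier_mat l n \<and> S \<noteq> {} \<and> \<eta> \<le> shortcode_stay l n S \<longrightarrow>
    (\<exists>T. nice l n r T \<and> \<delta> * real (card T) \<le> real (card (S \<inter> T))))"
  proof (cases "\<eta> \<le> 1")
    \<comment> \<open>For \<eta> above 1 the premise fails, as it bounds a probability from
      below.\<close>
    case False
    then have "\<not> \<eta> \<le> shortcode_stay l n S" for l n S
      using shortcode_stay_le_1[of l n S] by linarith
    then show ?thesis
      by (intro exI[of _ 1]) auto
  next
    case True
    \<comment> \<open>Half of \<eta> survives the removal of degenerate steps, and the degree bound
      divides by 8, so a Grassmann step stays with probability at least \<open>\<eta>/16\<close>.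
      Halving once more makes the inequality strict, as GEH demands.\<close>
    define \<eta>' where "\<eta>' = 1 - \<eta> / 32"
    have \<eta>': "0 < \<eta>'" "\<eta>' < 1"
      using \<eta> True by (auto simp: \<eta>'_def)
    obtain \<delta> r where \<delta>: "\<delta> > 0" and geh: "\<And>l n S. 0 < l \<Longrightarrow> l < n \<Longrightarrow> S \<subseteq> grassmann_verts l n \<Longrightarrow> S \<noteq> {} \<Longrightarrow>
      expansion (grassmann_nbrs l n) S < \<eta>' \<Longrightarrow>
      (\<exists>r1 r2 Q W. r1 + r2 \<le> r \<and> F2_subspace n Q \<and> F2_dim n Q = r1 \<and> F2_subspace n W \<and> F2_dim n W + r2 = n \<and>
        zoom l n Q W \<noteq> {} \<and> measure_pmf.prob (pmf_of_set (zoom l n Q W)) S \<ge> \<delta>)"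
      using assms \<eta>' unfolding GEH_def by metis
    \<comment> \<open>From \<open>L\<close> on, degenerate steps contribute less than
      \<open>\<eta>/2\<close> to the stay probability.\<close>
    obtain L where L: "(1/2::real) ^ L < \<eta> / 4"
      using real_arch_pow_inv[of "\<eta> / 4" "1/2"] \<eta> by auto
    have small: "(1/2::real) ^ k < \<eta> / 4" if "L \<le> k" for k
      using power_decreasing[OF that, of "1/2::real"] L by linarith
    show ?thesis
    \<comment> \<open>A singleton inside \<open>S\<close> has density 1, hence the cap on \<delta>;
      fixing it takes up to \<open>L\<close> constraints, hence the maximum.\<close>
    proof (intro exI[of _ "min \<delta> 1"] exI[of _ "max r L"] conjI allI impI)
      show "0 < min \<delta> 1"
        using \<delta> by simp
    next
      fix l m :: nat and S :: "bit Matrix.mat set"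
      assume "S \<subseteq> carrier_mat l m \<and> S \<noteq> {} \<and> \<eta> \<le> shortcode_stay l m S"
      then have S: "S \<subseteq> carrier_mat l m" "S \<noteq> {}" and stay: "\<eta> \<le> shortcode_stay l m S"
        by auto
      have finS: "finite S"
        using S finite_carrier_mat_bit finite_subset by blast
      show "\<exists>T. nice l m (max r L) T \<and> min \<delta> 1 * real (card T) \<le> real (card (S \<inter> T))"
      proof (cases "l < L \<or> m < L")
        case True
        obtain M where M: "M \<in> S"
          using S by blast
        then have "S \<inter> {M} = {M}"
          by blast
        then have "min \<delta> 1 * real (card {M}) \<le> real (card (S \<inter> {M}))"
          by simp
        moreover have "nice l m (max r L) {M}"
          using M S True by (intro singleton_nice) auto
        ultimately show ?thesis
          by blast
      next
        case False
        then have lm: "(1/2::real) ^ l < \<eta> / 4" "(1/2::real) ^ m < \<eta> / 4"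
          using small by auto
        \<comment> \<open>For \<open>l = 0\<close> or \<open>m = 0\<close> the power would be 1,
          which is not below \<open>\<eta>/4\<close>.\<close>
        then have pos: "0 < l" "0 < m"
          using \<open>\<eta> \<le> 1\<close> by (auto intro!: gr0I)
        let ?S = "graph_space ` S" and ?K = "real (card S) * 2 ^ (l + m)"
        have K: "?K > 0"
          using S finS by (simp add: card_gt_0_iff)
        have "real (card S) * (2 ^ l + 2 ^ m) = ?K * ((1/2) ^ m + (1/2) ^ l)"
          by (simp add: power_add power_divide field_simps)
        also have "\<dots> \<le> ?K * (\<eta> / 2)"
          using K lm by (intro mult_left_mono) auto
        finally have "real (card S) * (2 ^ l + 2 ^ m) \<le> ?K * (\<eta> / 2)" .
        moreover have "\<eta> * ?K \<le> shortcode_stay l m S * ?K"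
          using stay K by (intro mult_right_mono) auto
        ultimately have "\<eta> / 2 * ?K \<le> real (card (stay_triples l m S))"
          using stay_triples_bounds(2)[OF S] by (simp add: algebra_simps)
        also have "\<dots> \<le> (1 - expansion (grassmann_nbrs l (l + m)) ?S) * (8 * ?K)"
          by (rule expansion_graph_space[OF S pos])
        finally have "(\<eta> / 2) * ?K \<le> ((1 - expansion (grassmann_nbrs l (l + m)) ?S) * 8) * ?K"
          by (simp only: mult.assoc)
        then have "\<eta> / 2 \<le> (1 - expansion (grassmann_nbrs l (l + m)) ?S) * 8"
          using K mult_right_le_imp_le by blast
        then have "expansion (grassmann_nbrs l (l + m)) ?S < \<eta>'"
          using \<eta> by (simp add: \<eta>'_def)
        moreover have "?S \<subseteq> grassmann_verts l (l + m)" "?S \<noteq> {}"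
          using S graph_space_vert by auto
        ultimately obtain r1 r2 Q W where Q: "r1 + r2 \<le> r" "bit_subspace (l + m) Q" "F2_dim (l + m) Q = r1"
          and W: "bit_subspace (l + m) W" "F2_dim (l + m) W + r2 = l + m"
          and Z: "zoom l (l + m) Q W \<noteq> {}" "measure_pmf.prob (pmf_of_set (zoom l (l + m) Q W)) ?S \<ge> \<delta>"
          using geh[of l "l + m" ?S] pos unfolding F2_subspace_iff by (metis less_add_same_cancel1)
        let ?Z = "zoom l (l + m) Q W" and ?T = "zoom_mats l m Q W"
        have Zpos: "real (card ?Z) > 0"
          using Z(1) finite_zoom by (simp add: card_gt_0_iff)
        have "\<delta> * real (card ?Z) \<le> real (card (?Z \<inter> ?S))"
          using Z(2) Zpos by (simp add: measure_pmf_of_set[OF Z(1) finite_zoom] field_simps)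
        \<comment> \<open>The zoom may contain spaces that are not graphs, but the image of
          \<open>S\<close> does not; restricting to \<open>?T\<close> loses nothing of
          \<open>S\<close>.\<close>
        also have "?Z \<inter> ?S = graph_space ` (S \<inter> ?T)"
          using S(1) graph_space_vert by (auto simp: zoom_def zoom_mats_def)
        also have "card (graph_space ` (S \<inter> ?T)) = card (S \<inter> ?T)"
          using S(1) by (intro card_image inj_on_subset[OF graph_space_inj[of l m]]) auto
        finally have main: "\<delta> * real (card ?Z) \<le> real (card (S \<inter> ?T))" .
        \<comment> \<open>Positive density is what makes the set of matrices nonempty, as niceness
          requires.\<close>
        have "real (card (S \<inter> ?T)) > 0"
          using main Zpos \<delta> by (meson less_le_trans mult_pos_pos)
        then have ne: "?T \<noteq> {}"
          by auto
        have "card ?T = card (graph_space ` ?T)"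
          by (intro card_image[symmetric] inj_on_subset[OF graph_space_inj[of l m]]) (auto simp: zoom_mats_def)
        also have "\<dots> \<le> card ?Z"
          by (intro card_mono finite_zoom) (auto simp: graph_space_zoom_mats)
        finally have "min \<delta> 1 * real (card ?T) \<le> \<delta> * real (card ?Z)"
          using \<delta> by (intro mult_mono) auto
        then have "min \<delta> 1 * real (card ?T) \<le> real (card (S \<inter> ?T))"
          using main by linarith
        moreover have "nice l m (max r L) ?T"
          using Q(1) card_bit_subspace_dim[OF Q(2)]
          by (intro zoom_mats_nice[OF Q(2) _ W(1) card_bit_subspace_dim[OF W(1)] W(2) _ ne, of r1]) (auto simp: Q(3))
        ultimately show ?thesis
          by blast
      qed
    qed
  qed
qed

section \<open>From the shortcode graph to the Grassmann graph\<close>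

lemma bit_adj_Aut:
  assumes g: "g \<in> Aut n" and "bit_adj n A B"
  shows "bit_adj n (g ` A) (g ` B)"
proof -
  have "g ` A \<inter> g ` B = g ` (A \<inter> B)"
    using AutD(4)[OF g] by (simp add: image_Int)
  then show ?thesis
    using assms Aut_image_bit_subspace[OF g] bit_subspace_Int by (simp add: bit_adj_def)
qed

lemma grassmann_verts_Aut: "g \<in> Aut n \<Longrightarrow> V \<in> grassmann_verts l n \<Longrightarrow> g ` V \<in> grassmann_verts l n"
  by (simp add: mem_grassmann_verts Aut_image_bit_subspace)

lemma card_grassmann_nbrs_const:
  assumes A: "A \<in> grassmann_verts l n" and B: "B \<in> grassmann_verts l n"
  shows "card (grassmann_nbrs l n A) = card (grassmann_nbrs l n B)"
proof -
  have le: "card (grassmann_nbrs l n A) \<le> card (grassmann_nbrs l n B)"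
    if A: "A \<in> grassmann_verts l n" and B: "B \<in> grassmann_verts l n" for A B
  proof -
    obtain g where g: "g \<in> Aut n" "g ` A = B"
      using Aut_transitive[of n A B] A B by (auto simp: mem_grassmann_verts)
    have "inj_on ((`) g) (grassmann_nbrs l n A)"
      using AutD(4)[OF g(1)] by (simp add: inj_on_def inj_image_eq_iff)
    moreover have "(`) g ` grassmann_nbrs l n A \<subseteq> grassmann_nbrs l n B"
      using mem_grassmann_nbrs[OF A] mem_grassmann_nbrs[OF B] bit_adj_Aut[OF g(1)] g(2) by auto
    ultimately show ?thesis
      using finite_grassmann_nbrs by (rule card_inj_on_le)
  qed
  show ?thesis
    using le[OF A B] le[OF B A] by simp
qed

text \<open>Composition with an automorphism from one target edge to the other is injective. Hence a
  uniform automorphism sends a fixed edge to a uniform ordered edge.\<close>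

lemma card_Aut_adjacent_const:
  assumes "bit_adj n C D" "bit_adj n C' D'" "card C = card C'"
  shows "card {g \<in> Aut n. g ` A = C \<and> g ` B = D} = card {g \<in> Aut n. g ` A = C' \<and> g ` B = D'}"
proof -
  have le: "card {g \<in> Aut n. g ` A = C \<and> g ` B = D} \<le> card {g \<in> Aut n. g ` A = C' \<and> g ` B = D'}"
    if CD: "bit_adj n C D" and CD': "bit_adj n C' D'" and card: "card C = card C'" for C D C' D'
  proof -
    obtain h where h: "h \<in> Aut n" "h ` C = C'" "h ` D = D'"
      using Aut_transitive_adjacent[OF CD CD' card] .
    show ?thesis
    proof (rule card_inj_on_le[where f = "\<lambda>g. h \<circ> g"])
      show "inj_on (\<lambda>g. h \<circ> g) {g \<in> Aut n. g ` A = C \<and> g ` B = D}"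
        using AutD(4)[OF h(1)] by (intro inj_onI) (simp add: fun.inj_map_strong fun_eq_iff inj_eq)
      show "(\<lambda>g. h \<circ> g) ` {g \<in> Aut n. g ` A = C \<and> g ` B = D} \<subseteq> {g \<in> Aut n. g ` A = C' \<and> g ` B = D'}"
      proof (intro image_subsetI CollectI conjI)
        fix g assume "g \<in> {g \<in> Aut n. g ` A = C \<and> g ` B = D}"
        then have g: "g \<in> Aut n" "g ` A = C" "g ` B = D"
          by auto
        show "h \<circ> g \<in> Aut n"
          using Aut_comp[OF h(1) g(1)] .
        show "(h \<circ> g) ` A = C'" "(h \<circ> g) ` B = D'"
          unfolding image_comp[symmetric] g h by (rule refl)+
      qed
    qed (simp add: finite_Aut)
  qed
  show ?thesis
    using le[OF assms] le[OF assms(2,1) assms(3)[symmetric]] by simp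
qed

text \<open>All ordered edges are hit equally often and all degrees agree. So among the
  automorphisms that take \<open>A\<close> to a member of \<open>S\<close>, the images of
  \<open>A\<close> and \<open>B\<close> form a uniform member and a uniform neighbour of it, which
  is the experiment defining the expansion.\<close>

lemma Aut_edge_probability:
  assumes S: "S \<subseteq> grassmann_verts l n" "S \<noteq> {}" and A: "A \<in> grassmann_verts l n" and AB: "bit_adj n A B"
  shows "real (card {g \<in> Aut n. g ` A \<in> S \<and> g ` B \<in> S}) =
    (1 - expansion (grassmann_nbrs l n) S) * real (card {g \<in> Aut n. g ` A \<in> S})"
proof -
  let ?N = "grassmann_nbrs l n"
  let ?f = "\<lambda>V V'. {g \<in> Aut n. g ` A = V \<and> g ` B = V'}"
  have finS: "finite S"
    using S finite_grassmann_verts finite_subset by blast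
  define D where "D = card (?N A)"
  define \<beta> where "\<beta> = card (?f A B)"
  have D: "card (?N V) = D" if "V \<in> S" for V
    unfolding D_def using that S A by (intro card_grassmann_nbrs_const) auto
  have "B \<in> ?N A"
    using AB mem_grassmann_nbrs[OF A] by simp
  then have Dpos: "D > 0"
    using finite_grassmann_nbrs by (auto simp: D_def card_gt_0_iff)
  have \<beta>: "card (?f V V') = \<beta>" if "V \<in> S" "V' \<in> ?N V" for V V'
  proof -
    have V: "V \<in> grassmann_verts l n"
      using that S by blast
    show ?thesis
      unfolding \<beta>_def
      using mem_grassmann_nbrs[OF V] that AB V A
      by (intro card_Aut_adjacent_const) (auto simp: mem_grassmann_verts)
  qed
  have finf: "finite (?f V V')" for V V'
    using finite_Aut by simp
  have nbr: "g ` B \<in> ?N (g ` A)" if "g \<in> Aut n" for g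
    using mem_grassmann_nbrs[OF grassmann_verts_Aut[OF that A]] bit_adj_Aut[OF that AB] by simp
  \<comment> \<open>Stated for a family \<open>F\<close> so that one fibre count serves both all
    neighbours and the neighbours inside \<open>S\<close>.\<close>
  have count: "card (\<Union>V\<in>S. \<Union>V'\<in>F V. ?f V V') = (\<Sum>V\<in>S. card (F V) * \<beta>)"
    if F: "\<And>V. V \<in> S \<Longrightarrow> F V \<subseteq> ?N V" for F
  proof -
    have finF: "finite (F V)" if "V \<in> S" for V
      using F[OF that] finite_grassmann_nbrs finite_subset by blast
    have "card (\<Union>V\<in>S. \<Union>V'\<in>F V. ?f V V') = (\<Sum>V\<in>S. card (\<Union>V'\<in>F V. ?f V V'))"
      using finS finF finf by (intro card_UN_disjoint) auto
    also have "\<dots> = (\<Sum>V\<in>S. \<Sum>V'\<in>F V. card (?f V V'))"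
      using finF finf by (intro sum.cong refl card_UN_disjoint) auto
    also have "\<dots> = (\<Sum>V\<in>S. \<Sum>V'\<in>F V. \<beta>)"
      using F by (intro sum.cong refl \<beta>) auto
    finally show ?thesis
      by simp
  qed
  have "{g \<in> Aut n. g ` A \<in> S} = (\<Union>V\<in>S. \<Union>V'\<in>?N V. ?f V V')"
    using nbr by auto
  then have "card {g \<in> Aut n. g ` A \<in> S} = (\<Sum>V\<in>S. card (?N V) * \<beta>)"
    using count[of ?N] by simp
  also have "\<dots> = card S * D * \<beta>"
    by (simp add: D)
  finally have p1: "card {g \<in> Aut n. g ` A \<in> S} = card S * D * \<beta>" .
  have "{g \<in> Aut n. g ` A \<in> S \<and> g ` B \<in> S} = (\<Union>V\<in>S. \<Union>V'\<in>?N V \<inter> S. ?f V V')"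
    using nbr by auto
  then have p2: "card {g \<in> Aut n. g ` A \<in> S \<and> g ` B \<in> S} = (\<Sum>V\<in>S. card (?N V \<inter> S)) * \<beta>"
    using count[of "\<lambda>V. ?N V \<inter> S"] by (simp add: sum_distrib_right)
  have "1 - expansion ?N S = (\<Sum>V\<in>S. real (card (?N V \<inter> S)) / real (card (?N V))) / real (card S)"
    using finS S D Dpos finite_grassmann_nbrs by (intro expansion_eq) (force simp: card_gt_0_iff)+
  also have "\<dots> = (\<Sum>V\<in>S. real (card (?N V \<inter> S)) / real D) / real (card S)"
    by (simp add: D)
  finally have "(1 - expansion ?N S) * (real (card S) * real D) = (\<Sum>V\<in>S. real (card (?N V \<inter> S)))"
    using Dpos S finS by (simp add: sum_divide_distrib[symmetric] card_gt_0_iff)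
  then show ?thesis
    unfolding p1 p2 by (simp add: mult.assoc[symmetric])
qed

section \<open>Averaging over all charts\<close>

definition pullback :: "nat \<Rightarrow> nat \<Rightarrow> bvec set set \<Rightarrow> (bvec \<Rightarrow> bvec) \<Rightarrow> bit Matrix.mat set" where
  "pullback l m S g = {M \<in> carrier_mat l m. g ` graph_space M \<in> S}"

lemma card_filter_swap:
  assumes "finite A" "finite B"
  shows "(\<Sum>x\<in>A. card {y \<in> B. P x y}) = (\<Sum>y\<in>B. card {x \<in> A. P x y})"
proof -
  have "(\<Sum>x\<in>A. card {y \<in> B. P x y}) = (\<Sum>x\<in>A. \<Sum>y\<in>B. if P x y then 1 else 0)"
    using assms by (simp add: sum.If_cases Int_def)
  also have "\<dots> = (\<Sum>y\<in>B. \<Sum>x\<in>A. if P x y then 1 else 0)"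
    by (rule sum.swap)
  also have "\<dots> = (\<Sum>y\<in>B. card {x \<in> A. P x y})"
    using assms by (simp add: sum.If_cases Int_def)
  finally show ?thesis .
qed

lemma exists_good_chart:
  assumes S: "S \<subseteq> grassmann_verts l (l + m)" "S \<noteq> {}" and pos: "0 < l" "0 < m"
  obtains g where "g \<in> Aut (l + m)" "pullback l m S g \<noteq> {}"
    "shortcode_stay l m (pullback l m S g) \<ge> (1 - expansion (grassmann_nbrs l (l + m)) S) / 4"
proof -
  let ?n = "l + m" and ?A = "carrier_vec l - {0\<^sub>v l} :: bvec set" and ?B = "carrier_vec m - {0\<^sub>v m} :: bvec set"
  let ?G = "Aut ?n" and ?P = "pullback l m S"
  define s where "s = 1 - expansion (grassmann_nbrs l ?n) S"
  \<comment> \<open>The average number of stay triples per matrix of a pullback: the number of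
    nondegenerate pairs times the stay probability in the Grassmann graph.\<close>
  define K where "K = real (card (?A \<times> ?B)) * s"
  have s: "s \<ge> 0"
    by (simp add: s_def expansion_def)
  have finP: "finite (?P g)" for g
    by (rule finite_subset[OF _ finite_carrier_mat_bit[of l m]]) (auto simp: pullback_def)
  have finAB: "finite (?A \<times> ?B)"
    by simp
  let ?C = "carrier_mat l m :: bit Matrix.mat set"
  let ?Q = "\<lambda>g (M, a, b). g ` graph_space M \<in> S \<and> g ` graph_space (M + outer_prod a b) \<in> S"
  have triples: "stay_triples l m (?P g) = {x \<in> ?C \<times> ?A \<times> ?B. ?Q g x}" for g
    using outer_prod_carrier by (fastforce simp: stay_triples_def pullback_def)
  have edge: "real (card {g \<in> ?G. ?Q g (M, a, b)}) = s * real (card {g \<in> ?G. g ` graph_space M \<in> S})"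
    if "M \<in> ?C" "a \<in> ?A" "b \<in> ?B" for M a b
    using Aut_edge_probability[OF S graph_space_vert[OF that(1)] bit_adj_graph_space[OF that(1), of a b]] that
    by (simp add: s_def)
  have "(\<Sum>g\<in>?G. real (card (stay_triples l m (?P g)))) = real (\<Sum>g\<in>?G. card {x \<in> ?C \<times> ?A \<times> ?B. ?Q g x})"
    by (simp add: triples)
  also have "\<dots> = real (\<Sum>x\<in>?C \<times> ?A \<times> ?B. card {g \<in> ?G. ?Q g x})"
    by (subst card_filter_swap) (auto simp: finite_Aut finite_carrier_mat_bit)
  also have "\<dots> = (\<Sum>(M, a, b)\<in>?C \<times> ?A \<times> ?B. s * real (card {g \<in> ?G. g ` graph_space M \<in> S}))"
    unfolding of_nat_sum using edge by (intro sum.cong refl) auto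
  also have "\<dots> = (\<Sum>M\<in>?C. \<Sum>x\<in>?A \<times> ?B. s * real (card {g \<in> ?G. g ` graph_space M \<in> S}))"
    by (subst sum.cartesian_product) (simp add: case_prod_unfold)
  also have "\<dots> = K * real (\<Sum>M\<in>?C. card {g \<in> ?G. g ` graph_space M \<in> S})"
    by (simp add: K_def sum_distrib_left mult_ac)
  also have "(\<Sum>M\<in>?C. card {g \<in> ?G. g ` graph_space M \<in> S}) = (\<Sum>g\<in>?G. card (?P g))"
    by (subst card_filter_swap) (auto simp: finite_Aut finite_carrier_mat_bit pullback_def)
  finally have avg: "(\<Sum>g\<in>?G. real (card (stay_triples l m (?P g)))) = (\<Sum>g\<in>?G. K * real (card (?P g)))"
    by (simp add: sum_distrib_left)
  \<comment> \<open>The totals agree exactly, so not all nonempty pullbacks can fall short. Empty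
    ones contribute 0 to both sides; a single nonempty one would make the inequality of the sums
    strict.\<close>
  have "\<exists>g\<in>?G. ?P g \<noteq> {} \<and> K * real (card (?P g)) \<le> real (card (stay_triples l m (?P g)))"
  proof (rule ccontr)
    assume neg: "\<not> ?thesis"
    have le: "real (card (stay_triples l m (?P g))) \<le> K * real (card (?P g))" if "g \<in> ?G" for g
    proof (cases "?P g = {}")
      case True
      moreover have "stay_triples l m {} = {}"
        by (auto simp: stay_triples_def)
      ultimately show ?thesis
        by simp
    next
      case False
      then show ?thesis
        using neg that by force
    qed
    \<comment> \<open>Some pullback is nonempty: carry the graph of the zero matrix onto a member of
      \<open>S\<close>.\<close>
    obtain V where V: "V \<in> S"
      using S by blast
    then have Vs: "bit_subspace ?n V" "card V = 2 ^ l"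
      using S(1) mem_grassmann_verts by blast+
    have "(0\<^sub>m l m :: bit Matrix.mat) \<in> ?C"
      by simp
    moreover obtain g where g: "g \<in> ?G" "g ` graph_space (0\<^sub>m l m) = V"
      using Aut_transitive[OF bit_subspace_graph_space(1)[of "0\<^sub>m l m" l m] Vs(1)] Vs(2)
        bit_subspace_graph_space(2)[of "0\<^sub>m l m" l m] by (metis zero_carrier_mat)
    ultimately have ne: "?P g \<noteq> {}"
      using V unfolding pullback_def by blast
    have "(\<Sum>g\<in>?G. real (card (stay_triples l m (?P g)))) < (\<Sum>g\<in>?G. K * real (card (?P g)))"
      using finite_Aut le neg g(1) ne by (intro sum_strict_mono_ex1) force+
    then show False
      using avg by simp
  qed
  then obtain g where g: "g \<in> ?G" "?P g \<noteq> {}"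
    and Kg: "K * real (card (?P g)) \<le> real (card (stay_triples l m (?P g)))"
    by blast
  \<comment> \<open>At least half of the vectors are nonzero; used for \<open>a\<close> and for
    \<open>b\<close>, this yields the factor 1/4.\<close>
  have nz: "real (card (carrier_vec k - {0\<^sub>v k} :: bvec set)) \<ge> 2 ^ k / 2" if "0 < k" for k
  proof -
    have "(2::real) \<le> 2 ^ k"
      using that power_increasing[of 1 k "2::real"] by simp
    then show ?thesis
      by (simp add: card_Diff_subset card_carrier_vec_bit of_nat_diff)
  qed
  have "2 ^ l / 2 * (2 ^ m / 2) \<le> real (card ?A) * real (card ?B)"
    using nz pos by (intro mult_mono) auto
  from mult_right_mono[OF this s] have "2 ^ l / 2 * (2 ^ m / 2) * s \<le> K"
    unfolding K_def card_cartesian_product of_nat_mult .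
  then have "2 ^ ?n / 4 * s \<le> K"
    by (simp add: power_add)
  have "s / 4 * (real (card (?P g)) * 2 ^ ?n) = 2 ^ ?n / 4 * s * real (card (?P g))"
    by simp
  also have "\<dots> \<le> K * real (card (?P g))"
    using \<open>2 ^ ?n / 4 * s \<le> K\<close> by (intro mult_right_mono) auto
  also have "\<dots> \<le> real (card (stay_triples l m (?P g)))"
    by (rule Kg)
  also have "\<dots> \<le> shortcode_stay l m (?P g) * (real (card (?P g)) * 2 ^ ?n)"
    by (rule stay_triples_bounds(1)) (use g in \<open>auto simp: pullback_def\<close>)
  finally have "s / 4 \<le> shortcode_stay l m (?P g)"
    using g(2) finP by (simp add: card_gt_0_iff)
  then show ?thesis
    using that g by (simp add: s_def)
qed

lemma zoom_Aut:
  assumes g: "g \<in> Aut n"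
  shows "zoom l n (g ` Q) (g ` W) = (`) g ` zoom l n Q W"
proof (intro subset_antisym subsetI)
  fix V assume V: "V \<in> zoom l n (g ` Q) (g ` W)"
  let ?h = "inv_into UNIV g"
  have "?h ` V \<in> zoom l n Q W"
    using V Aut_image_bit_subspace[OF Aut_inv[OF g]] image_mono[of "g ` Q" V ?h] image_mono[of V "g ` W" ?h]
    by (simp add: mem_zoom Aut_inv_image[OF g])
  then show "V \<in> (`) g ` zoom l n Q W"
    using Aut_inv_image(2)[OF g, of V] by (metis image_eqI)
next
  fix V assume "V \<in> (`) g ` zoom l n Q W"
  then obtain V' where "V' \<in> zoom l n Q W" "V = g ` V'"
    by blast
  then show "V \<in> zoom l n (g ` Q) (g ` W)"
    using Aut_image_bit_subspace[OF g] image_mono[of Q V' g] image_mono[of V' W g] by (simp add: mem_zoom)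
qed

lemma ISH_imp_GEH:
  assumes "ISH"
  shows "GEH"
  unfolding GEH_def
proof (intro allI impI, elim conjE)
  fix \<eta> :: real assume \<eta>: "0 < \<eta>" "\<eta> < 1"
  \<comment> \<open>The stay probability that \<open>exists_good_chart\<close> guarantees when the
    expansion is below \<eta>.\<close>
  then have "(1 - \<eta>) / 4 > 0"
    by simp
  then obtain \<delta> r where \<delta>: "\<delta> > 0" and ish: "\<And>l m S. S \<subseteq> carrier_mat l m \<Longrightarrow> S \<noteq> {} \<Longrightarrow>
      shortcode_stay l m S \<ge> (1 - \<eta>) / 4 \<Longrightarrow>
      (\<exists>T. nice l m r T \<and> real (card (S \<inter> T)) \<ge> \<delta> * real (card T))"
    using assms unfolding ISH_def by metis
  show "\<exists>\<delta> r. 0 < \<delta> \<and> (\<forall>l n S. 0 < l \<and> l < n \<and> S \<subseteq> grassmann_verts l n \<and> S \<noteq> {} \<and>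
      expansion (grassmann_nbrs l n) S < \<eta> \<longrightarrow>
    (\<exists>r1 r2 Q W. r1 + r2 \<le> r \<and> F2_subspace n Q \<and> F2_dim n Q = r1 \<and> F2_subspace n W \<and> F2_dim n W + r2 = n \<and>
      zoom l n Q W \<noteq> {} \<and> \<delta> \<le> measure_pmf.prob (pmf_of_set (zoom l n Q W)) S))"
  \<comment> \<open>The factor 4 is paid in \<open>card_zoom_mats_ge\<close> for passing from graphs
    to the full zoom. The bound \<open>r\<close> is kept, since automorphisms preserve
    dimensions.\<close>
  proof (rule exI[of _ "\<delta> / 4"], rule exI[of _ r], intro conjI allI impI, goal_cases)
    case 1
    then show ?case
      using \<delta> by simp
  next
    case (2 l n S)
    define m where "m = n - l"
    have n: "n = l + m" and pos: "0 < l" "0 < m"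
      using 2 by (auto simp: m_def)
    have S: "S \<subseteq> grassmann_verts l (l + m)" "S \<noteq> {}" and exp: "expansion (grassmann_nbrs l (l + m)) S < \<eta>"
      using 2 by (auto simp: n)
    obtain g where g: "g \<in> Aut (l + m)" "pullback l m S g \<noteq> {}"
      "shortcode_stay l m (pullback l m S g) \<ge> (1 - expansion (grassmann_nbrs l (l + m)) S) / 4"
      using exists_good_chart[OF S pos] .
    let ?P = "pullback l m S g"
    obtain T where T: "nice l m r T" "real (card (?P \<inter> T)) \<ge> \<delta> * real (card T)"
      using ish[of ?P l m] g exp by (auto simp: pullback_def)
    obtain Q W q w where Q: "bit_subspace (l + m) Q" "card Q = 2 ^ q" and W: "bit_subspace (l + m) W" "card W = 2 ^ w"
      and qw: "q + (l + m) \<le> r + w" and TQ: "T = zoom_mats l m Q W" "T \<noteq> {}"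
      using nice_imp_zoom_mats[OF T(1)] .
    \<comment> \<open>Makes the witness \<open>l + m - w\<close> for the codimension an exact
      difference.\<close>
    have "(2::nat) ^ w \<le> 2 ^ (l + m)"
      using card_mono[OF finite_carrier_vec_bit, of W "l + m"] W bit_subspaceD(1)[OF W(1)] card_carrier_vec_bit[of "l + m"] by auto
    then have w: "w \<le> l + m"
      by simp
    let ?Q = "g ` Q" and ?W = "g ` W"
    let ?Z = "zoom l (l + m) ?Q ?W"
    have Qs: "bit_subspace (l + m) ?Q" "F2_dim (l + m) ?Q = q"
      using Aut_image_bit_subspace[OF g(1) Q(1)] Q(2) by (auto simp: F2_dim_eq_iff)
    have Ws: "bit_subspace (l + m) ?W" "F2_dim (l + m) ?W = w"
      using Aut_image_bit_subspace[OF g(1) W(1)] W(2) by (auto simp: F2_dim_eq_iff)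
    have injg: "inj ((`) g)"
      using AutD(4)[OF g(1)] by (simp add: inj_image_eq_iff inj_on_def)
    have Zeq: "?Z = (`) g ` zoom l (l + m) Q W"
      by (rule zoom_Aut[OF g(1)])
    have Zcard: "real (card ?Z) \<le> 4 * real (card T)"
      using card_zoom_mats_ge[OF Q W] TQ card_image[OF inj_on_subset[OF injg], of "zoom l (l + m) Q W"]
      by (simp add: Zeq)
    have sub: "graph_space ` T \<subseteq> zoom l (l + m) Q W"
      unfolding TQ(1) graph_space_zoom_mats by blast
    have Zne: "?Z \<noteq> {}"
      using sub TQ(2) by (auto simp: Zeq)
    have "card (?P \<inter> T) \<le> card (?Z \<inter> S)"
    proof (rule card_inj_on_le[where f = "\<lambda>M. g ` graph_space M"])
      have "inj_on graph_space (?P \<inter> T)"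
        by (rule inj_on_subset[OF graph_space_inj[of l m]]) (auto simp: pullback_def)
      then show "inj_on (\<lambda>M. g ` graph_space M) (?P \<inter> T)"
        using comp_inj_on[OF _ inj_on_subset[OF injg], of graph_space "?P \<inter> T"] by (simp add: comp_def)
      show "(\<lambda>M. g ` graph_space M) ` (?P \<inter> T) \<subseteq> ?Z \<inter> S"
        using sub by (auto simp: Zeq pullback_def)
    qed (simp add: finite_zoom)
    then have "\<delta> * real (card T) \<le> real (card (?Z \<inter> S))"
      using T(2) by linarith
    moreover have "\<delta> / 4 * real (card ?Z) \<le> \<delta> * real (card T)"
      using mult_left_mono[OF Zcard, of "\<delta> / 4"] \<delta> by simp
    ultimately have "\<delta> / 4 * real (card ?Z) \<le> real (card (?Z \<inter> S))"
      by linarith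
    moreover have "real (card ?Z) > 0"
      using Zne finite_zoom by (simp add: card_gt_0_iff)
    ultimately have "\<delta> / 4 \<le> measure_pmf.prob (pmf_of_set ?Z) S"
      by (simp add: measure_pmf_of_set[OF Zne finite_zoom] pos_le_divide_eq)
    then show ?case
      unfolding n F2_subspace_iff
      using Qs Ws Zne w qw
      by - (rule exI[of _ q], rule exI[of _ "l + m - w"], rule exI[of _ ?Q], rule exI[of _ ?W], simp)
  qed
qed

theorem theorem3:
  shows "GEH \<longleftrightarrow> ISH"
  using GEH_imp_ISH ISH_imp_GEH by blast

end
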